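(* Let $M\in M_2(\mathbb{Z})$ be an expanding matrix and let $D=\{(0,0)^t,(\alpha_1,\alpha_2)^t,(\beta_1,\beta_2)^t\}\subset\mathbb{Z}^2$ be an integer digit set with $\alpha_1\beta_2-\alpha_2\beta_1\notin3\mathbb{Z}$. If $\det(M)\notin3\mathbb{Z}$, then $L^2(\mu_{M,D})$ contains at most $9$ mutually orthogonal exponential functions, and the number $9$ is the best. Moreover, the best number $9$ is attained for $L^2(\mu_{M,D})$ if and only if $AMB\in\mathfrak{M}_2\pmod 3$, where $B=\begin{bmatrix}\alpha_1&\beta_1\\ \alpha_2&\beta_2\end{bmatrix}$ and $A\in GL_2(3)$ is an integer matrix satisfying $AB=I\pmod 3$.
   Context: A matrix is expanding if all its eigenvalues have modulus $>1$. For an expanding $M\in M_2(\mathbb{R})$ and a finite $D\subset\mathbb{R}^2$, the self-affine measure $\mu_{M,D}$ is the unique Borel probability measure $\mu$ with $\mu=\frac{1}{|D|}\sum_{d\in D}\mu\circ\phi_d^{-1}$, where $\phi_d(x)=M^{-1}(x+d)$. Exponential functions are the functions $x\mapsto e^{2\pi i\langle\lambda,x\rangle}$, $\lambda\in\mathbb{R}^2$. An integer matrix $A$ is said to be in $GL_2(3)$ if its reduction mod $3$ is invertible. The statement $AMB\in\mathfrak{M}_2\pmod3$ means that $AMB$ is entrywise congruent mod $3$ to an element of $\mathfrak{M}_2$, where $\mathfrak{M}_2$ is the set of 12 matrices $$\mathfrak{M}_2=\pm\left\{\begin{bmatrix}0&1\\1&1\end{bmatrix},\begin{bmatrix}0&1\\1&-1\end{bmatrix},\begin{bmatrix}1&1\\1&0\end{bmatrix},\begin{bmatrix}1&-1\\1&1\end{bmatrix},\begin{bmatrix}1&-1\\-1&0\end{bmatrix},\begin{bmatrix}1&1\\-1&1\end{bmatrix}\right\}.$$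 "The number $9$ is the best" means that the upper bound $9$ cannot be replaced by a smaller number valid for all such $M$ and $D$. *)

theory Defs
  imports "HOL-Probability.Probability" "HOL-Number_Theory.Cong"
begin

definition expanding :: "real^2^2 \<Rightarrow> bool" where
  "expanding M \<longleftrightarrow>
     (\<forall>z::complex. (\<exists>v. v \<noteq> 0 \<and> map_matrix complex_of_real M *v v = z *s v) \<longrightarrow> cmod z > 1)"

definition ifs_map :: "real^2^2 \<Rightarrow> real^2 \<Rightarrow> real^2 \<Rightarrow> real^2" where
  "ifs_map M d x = matrix_inv M *v (x + d)"

definition is_self_affine_measure :: "real^2^2 \<Rightarrow> (real^2) set \<Rightarrow> (real^2) measure \<Rightarrow> bool" where
  "is_self_affine_measure M D \<mu> \<longleftrightarrow>
     prob_space \<mu> \<and> sets \<mu> = sets borel \<and>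
     (\<forall>E\<in>sets borel. measure \<mu> E = (\<Sum>d\<in>D. measure \<mu> (ifs_map M d -` E)) / real (card D))"

text \<open>For expanding \<open>M\<close> and finite nonempty \<open>D\<close> there is exactly one such measure
  (Hutchinson); outside that case the description may be unspecified.\<close>
definition self_affine_measure :: "real^2^2 \<Rightarrow> (real^2) set \<Rightarrow> (real^2) measure" where
  "self_affine_measure M D = (THE \<mu>. is_self_affine_measure M D \<mu>)"

definition expo :: "real^2 \<Rightarrow> real^2 \<Rightarrow> complex" where
  "expo l x = exp (2 * complex_of_real pi * \<i> * complex_of_real (l \<bullet> x))"

definition L2_inner :: "'a measure \<Rightarrow> ('a \<Rightarrow> complex) \<Rightarrow> ('a \<Rightarrow> complex) \<Rightarrow> complex" where
  "L2_inner \<mu> f g = (LINT x|\<mu>. f x * cnj (g x))"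

text \<open>The elements of \<open>S\<close> are functions rather than classes modulo null sets. This does not
  affect cardinalities: for a probability measure, orthogonal exponentials (which have norm 1)
  lie in different classes.\<close>
definition orthogonal_expos :: "(real^2) measure \<Rightarrow> (real^2 \<Rightarrow> complex) set \<Rightarrow> bool" where
  "orthogonal_expos \<mu> S \<longleftrightarrow>
     S \<subseteq> range expo \<and> (\<forall>f\<in>S. \<forall>g\<in>S. f \<noteq> g \<longrightarrow> L2_inner \<mu> f g = 0)"

definition at_most_orthogonal_expos :: "(real^2) measure \<Rightarrow> nat \<Rightarrow> bool" where
  "at_most_orthogonal_expos \<mu> n \<longleftrightarrow>
     (\<forall>S. orthogonal_expos \<mu> S \<longrightarrow> finite S \<and> card S \<le> n)"

definition attains_orthogonal_expos :: "(real^2) measure \<Rightarrow> nat \<Rightarrow> bool" where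
  "attains_orthogonal_expos \<mu> n \<longleftrightarrow>
     (\<exists>S. orthogonal_expos \<mu> S \<and> finite S \<and> card S = n)"

definition admissible :: "int^2^2 \<Rightarrow> int \<Rightarrow> int \<Rightarrow> int \<Rightarrow> int \<Rightarrow> bool" where
  "admissible M \<alpha>1 \<alpha>2 \<beta>1 \<beta>2 \<longleftrightarrow>
     expanding (map_matrix real_of_int M) \<and>
     \<not> 3 dvd (\<alpha>1 * \<beta>2 - \<alpha>2 * \<beta>1) \<and> \<not> 3 dvd det M"

definition digit_set :: "int \<Rightarrow> int \<Rightarrow> int \<Rightarrow> int \<Rightarrow> (real^2) set" where
  "digit_set \<alpha>1 \<alpha>2 \<beta>1 \<beta>2 =
     {vector [0, 0], vector [real_of_int \<alpha>1, real_of_int \<alpha>2],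
      vector [real_of_int \<beta>1, real_of_int \<beta>2]}"

definition \<mu>_MD :: "int^2^2 \<Rightarrow> int \<Rightarrow> int \<Rightarrow> int \<Rightarrow> int \<Rightarrow> (real^2) measure" where
  "\<mu>_MD M \<alpha>1 \<alpha>2 \<beta>1 \<beta>2 =
     self_affine_measure (map_matrix real_of_int M) (digit_set \<alpha>1 \<alpha>2 \<beta>1 \<beta>2)"

definition B_mat :: "int \<Rightarrow> int \<Rightarrow> int \<Rightarrow> int \<Rightarrow> int^2^2" where
  "B_mat \<alpha>1 \<alpha>2 \<beta>1 \<beta>2 = vector [vector [\<alpha>1, \<beta>1], vector [\<alpha>2, \<beta>2]]"

definition mat_cong3 :: "int^2^2 \<Rightarrow> int^2^2 \<Rightarrow> bool" where
  "mat_cong3 P Q \<longleftrightarrow> (\<forall>i j. [P $ i $ j = Q $ i $ j] (mod 3))"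

text \<open>The integer matrix \<open>A\<close> reduces modulo 3 to an invertible matrix; the inverse over the
  field with three elements is represented by an integer lift \<open>C\<close>.\<close>
definition in_GL2_3 :: "int^2^2 \<Rightarrow> bool" where
  "in_GL2_3 A \<longleftrightarrow> (\<exists>C. mat_cong3 (A ** C) (mat 1) \<and> mat_cong3 (C ** A) (mat 1))"

definition frakM2 :: "(int^2^2) set" where
  "frakM2 = (let P =
     {vector [vector [0, 1], vector [1, 1]],
      vector [vector [0, 1], vector [1, -1]],
      vector [vector [1, 1], vector [1, 0]],
      vector [vector [1, -1], vector [1, 1]],
      vector [vector [1, -1], vector [-1, 0]],
      vector [vector [1, 1], vector [-1, 1]]}
   in P \<union> uminus ` P)"

end

theory Submission
  imports Defs
begin

text \<open>
  Write \<open>\<mu>\<close> for the self-affine measure, \<open>A = M\<inverse>\<close>, \<open>N\<close> for the transpose of \<open>M\<close>, and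
  \<open>\<alpha>, \<beta>\<close> for the two nonzero digits, with \<open>b = \<alpha>\<^sub>1 \<beta>\<^sub>2 - \<alpha>\<^sub>2 \<beta>\<^sub>1\<close>. Two exponentials with frequencies
  \<open>l, l'\<close> are orthogonal iff the Fourier transform of \<open>\<mu>\<close> vanishes at \<open>\<xi> = l - l'\<close>. Self-affinity
  writes that transform as a product of the factors \<open>(1 + e(\<xi> \<bullet> A\<^sup>n \<alpha>) + e(\<xi> \<bullet> A\<^sup>n \<beta>)) / 3\<close>, \<open>n \<ge> 1\<close>, times a
  remainder that tends to 1, so it vanishes iff one factor does. Since three points of the unit
  circle sum to zero only if they form an equilateral triangle, this happens iff
  \<open>(\<xi> \<bullet> A\<^sup>n \<alpha>, \<xi> \<bullet> A\<^sup>n \<beta>)\<close> is congruent to \<open>\<plusminus>(1/3, -1/3)\<close> modulo integers (\<open>L2_inner_eq_0_iff\<close>).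

  Everything else is arithmetic modulo 3. By Cramer's rule such a \<open>\<xi>\<close> has an integral multiple
  \<open>3 b \<xi>\<close>, and that integer vector is congruent to \<open>\<plusminus> N\<^sup>n V\<close> modulo 3 for one fixed vector \<open>V\<close>
  (\<open>vanishing_residue\<close>). It is nonzero modulo 3 because \<open>b\<close> and \<open>det M\<close> are prime to 3. Hence the
  scaled differences of the frequencies to one of them are pairwise incongruent modulo 3, and
  the plane over the field with three elements has only 9 points.

  For 9 exponentials to exist the vectors \<open>\<plusminus> N\<^sup>n V\<close> must exhaust the 8 nonzero residues. By
  Cayley-Hamilton, \<open>N\<^sup>3\<close> is modulo 3 plus or minus a lower power of \<open>N\<close> unless
  \<open>det M \<equiv> -1\<close> and \<open>tr M\<close> is nonzero modulo 3, so otherwise there are at most 6 residues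
  \<open>\<plusminus> N\<^sup>n V\<close> and at most 7 exponentials (\<open>orthogonal_expos_card_le_7\<close>). In the exceptional case \<open>N\<close>
  has no eigenvector modulo 3 and acts on the four lines through the origin as a 4-cycle, so for
  every \<open>w\<close> that is nonzero modulo 3 one of \<open>w, N w, N\<^sup>2 w, N\<^sup>3 w\<close> is congruent to \<open>\<plusminus> V\<close>
  (\<open>orbit_mod_3_full\<close>). Consequently the nine frequencies \<open>N\<^sup>4 w / 3\<close> with \<open>w \<in> {0, 1, 2}\<^sup>2\<close> are
  orthogonal (\<open>attains_9\<close>).

  Finally, \<open>B\<close> and the given left inverse of it modulo 3 are inverse to each other, so conjugation
  leaves trace and determinant of \<open>M\<close> unchanged modulo 3, and the set of 12 matrices in the statement
  consists exactly of the residues with determinant \<open>-1\<close> and nonzero trace (\<open>frakM2_iff_trace_det\<close>).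

  All this presupposes that the measure exists and is unique. It exists as the law of
  \<open>A d\<^sub>0 + A\<^sup>2 d\<^sub>1 + \<dots>\<close> for independent uniformly distributed digits. It is unique because iterating
  the transfer operator on a Lipschitz function yields constants in the limit. Both use that the
  orbits of \<open>A\<close> are summable, which follows from the eigenvalues of \<open>M\<close> exceeding 1 in modulus.
\<close>

section \<open>Inverses of expanding matrices have summable orbits\<close>

text \<open>Summing the recurrence bounds every partial sum \<open>S\<close> of \<open>b\<close> by \<open>b 0 + q S + suminf c\<close>, and this
  inequality can be solved for \<open>S\<close>.\<close>

lemma summable_contracting_recurrence:
  fixes b c :: "nat \<Rightarrow> real"
  assumes b: "\<And>n. 0 \<le> b n" and c: "\<And>n. 0 \<le> c n" "summable c"
    and q: "0 \<le> q" "q < 1" and step: "\<And>n. b (Suc n) \<le> q * b n + c n"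
  shows "summable b"
proof (rule summableI_nonneg_bounded)
  fix n
  let ?S = "\<lambda>n. \<Sum>i<n. b i"
  have "?S n \<le> ?S (Suc n)" using b by simp
  also have "\<dots> = b 0 + (\<Sum>i<n. b (Suc i))" by (rule sum.lessThan_Suc_shift)
  also have "\<dots> \<le> b 0 + (\<Sum>i<n. q * b i + c i)" by (intro add_left_mono sum_mono step)
  also have "\<dots> \<le> b 0 + q * ?S n + suminf c"
    using sum_le_suminf[OF c(2), of "{..<n}"] c(1) by (simp add: sum.distrib sum_distrib_left)
  finally show "?S n \<le> (b 0 + suminf c) / (1 - q)"
    using q by (simp add: field_simps)
qed (rule b)

text \<open>With \<open>l, m\<close> the roots of the characteristic polynomial, \<open>a (Suc n) - l * a n\<close> is geometric with
  ratio \<open>m\<close>, so that \<open>a\<close> satisfies a contracting first-order recurrence with geometric error.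
  This argument covers the case \<open>l = m\<close> of a double root.\<close>

lemma summable_second_order_recurrence:
  fixes a :: "nat \<Rightarrow> complex"
  assumes rec: "\<And>n. a (Suc (Suc n)) = (l + m) * a (Suc n) - l * m * a n"
    and l: "cmod l < 1" and m: "cmod m < 1"
  shows "summable (\<lambda>n. cmod (a n))"
proof (rule summable_contracting_recurrence)
  have c: "a (Suc n) - l * a n = m ^ n * (a (Suc 0) - l * a 0)" for n
  proof (induction n)
    case (Suc n)
    have "a (Suc (Suc n)) - l * a (Suc n) = m * (a (Suc n) - l * a n)"
      by (simp add: rec algebra_simps)
    with Suc show ?case by simp
  qed simp
  show "summable (\<lambda>n. cmod (a (Suc n) - l * a n))"
  proof -
    have "(\<lambda>n. cmod (a (Suc n) - l * a n)) = (\<lambda>n. cmod m ^ n * cmod (a (Suc 0) - l * a 0))"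
      by (rule ext, subst c) (simp only: norm_mult norm_power)
    then show ?thesis using m by (simp only:) (intro summable_mult2 summable_geometric, simp)
  qed
  show "cmod (a (Suc n)) \<le> cmod l * cmod (a n) + cmod (a (Suc n) - l * a n)" for n
    using norm_triangle_ineq[of "l * a n" "a (Suc n) - l * a n"] by (simp add: norm_mult)
qed (use l in auto)

lemma trace_2: "trace (M :: 'a::comm_ring_1^2^2) = M $ 1 $ 1 + M $ 2 $ 2"
  by (simp add: trace_def sum_2)

lemma cayley_hamilton_2:
  fixes M :: "'a::comm_ring_1^2^2"
  shows "M *v (M *v v) = trace M *s (M *v v) - det M *s v"
  by (simp add: vec_eq_iff forall_2 matrix_vector_mult_def sum_2 trace_2 det_2 algebra_simps)

lemma expanding_root:
  assumes M: "expanding M"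
    and z: "z\<^sup>2 - complex_of_real (trace M) * z + complex_of_real (det M) = 0"
  shows "cmod z > 1"
proof -
  let ?M = "map_matrix complex_of_real M"
  let ?K = "?M - mat z"
  have "det ?K = z\<^sup>2 - complex_of_real (trace M) * z + complex_of_real (det M)"
    by (simp add: det_2 trace_2 mat_def power2_eq_square algebra_simps)
  with z have "\<not> invertible ?K" by (simp add: invertible_det_nz)
  then obtain v where "v \<noteq> 0" "?K *v v = 0"
    using matrix_left_invertible_ker[of ?K] invertible_left_inverse[of ?K] by auto
  moreover have "?K *v v = ?M *v v - z *s v"
    by (simp add: vec_eq_iff forall_2 matrix_vector_mult_def sum_2 mat_def algebra_simps)
  ultimately show ?thesis using M by (auto simp: expanding_def)
qed

lemma expanding_roots:
  assumes M: "expanding M"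
  obtains z w where "z + w = complex_of_real (trace M)" "z * w = complex_of_real (det M)"
    "cmod z > 1" "cmod w > 1"
proof
  let ?t = "complex_of_real (trace M)" and ?d = "complex_of_real (det M)"
  let ?r = "csqrt (?t\<^sup>2 - 4 * ?d)"
  have r: "?r\<^sup>2 = ?t\<^sup>2 - 4 * ?d" by simp
  show "(?t + ?r) / 2 + (?t - ?r) / 2 = ?t" by (simp add: field_simps)
  have "((?t + ?r) / 2) * ((?t - ?r) / 2) = (?t\<^sup>2 - ?r\<^sup>2) / 4"
    by (simp add: field_simps power2_eq_square)
  then show "((?t + ?r) / 2) * ((?t - ?r) / 2) = ?d" by (simp add: r)
  show "cmod ((?t + ?r) / 2) > 1"
  proof (rule expanding_root[OF M])
    have "((?t + ?r) / 2)\<^sup>2 - ?t * ((?t + ?r) / 2) + ?d = (?r\<^sup>2 - ?t\<^sup>2 + 4 * ?d) / 4"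
      by (simp add: field_simps power2_eq_square)
    then show "((?t + ?r) / 2)\<^sup>2 - ?t * ((?t + ?r) / 2) + ?d = 0" by (simp add: r)
  qed
  show "cmod ((?t - ?r) / 2) > 1"
  proof (rule expanding_root[OF M])
    have "((?t - ?r) / 2)\<^sup>2 - ?t * ((?t - ?r) / 2) + ?d = (?r\<^sup>2 - ?t\<^sup>2 + 4 * ?d) / 4"
      by (simp add: field_simps power2_eq_square)
    then show "((?t - ?r) / 2)\<^sup>2 - ?t * ((?t - ?r) / 2) + ?d = 0" by (simp add: r)
  qed
qed

lemma expanding_det_nonzero: "expanding M \<Longrightarrow> det M \<noteq> 0"
  by (rule expanding_roots[of M]) auto

lemma matrix_inv_cancel:
  fixes M :: "real^2^2"
  assumes "expanding M"
  shows "M *v (matrix_inv M *v v) = v" "matrix_inv M *v (M *v v) = v"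
proof -
  have "\<exists>A. M ** A = mat 1 \<and> A ** M = mat 1"
    using expanding_det_nonzero[OF assms] invertible_det_nz[of M] by (simp add: invertible_def)
  then have "M ** matrix_inv M = mat 1 \<and> matrix_inv M ** M = mat 1"
    unfolding matrix_inv_def by (rule someI_ex)
  then show "M *v (matrix_inv M *v v) = v" "matrix_inv M *v (M *v v) = v"
    by (simp_all add: matrix_vector_mul_assoc)
qed

text \<open>Cayley-Hamilton for \<open>M\<close>, read backwards, makes every coordinate of the orbit of the inverse satisfy
  a second-order recurrence whose characteristic roots are the reciprocals of the eigenvalues of \<open>M\<close>.\<close>

lemma expanding_summable_inverse_orbit:
  fixes M :: "real^2^2"
  assumes M: "expanding M"
  shows "summable (\<lambda>n. norm (((*v) (matrix_inv M) ^^ n) v))"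
proof -
  let ?A = "matrix_inv M"
  let ?x = "\<lambda>n. ((*v) ?A ^^ n) v"
  obtain z w where zw: "z + w = complex_of_real (trace M)" "z * w = complex_of_real (det M)"
    "cmod z > 1" "cmod w > 1"
    using expanding_roots[OF M] .
  then have nz: "z \<noteq> 0" "w \<noteq> 0" by auto
  \<comment> \<open>Apply Cayley-Hamilton to \<open>A\<^sup>2 u\<close> and cancel \<open>M\<close> against \<open>A\<close>.\<close>
  have rec: "det M *s ?x (Suc (Suc n)) = trace M *s ?x (Suc n) - ?x n" for n
  proof -
    have "?x n = trace M *s ?x (Suc n) - det M *s ?x (Suc (Suc n))"
      using cayley_hamilton_2[of M "?x (Suc (Suc n))"] by (simp add: matrix_inv_cancel[OF M])
    then show ?thesis by (simp add: algebra_simps)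
  qed
  have coord: "summable (\<lambda>n. \<bar>?x n $ i\<bar>)" for i
  proof -
    let ?a = "\<lambda>n. complex_of_real (?x n $ i)"
    have "z * w * ?a (Suc (Suc n)) = (z + w) * ?a (Suc n) - ?a n" for n
    proof -
      have "det M * ?x (Suc (Suc n)) $ i = trace M * ?x (Suc n) $ i - ?x n $ i"
        using rec[of n] by (metis vector_minus_component vector_smult_component)
      then show ?thesis by (simp add: zw(1,2) flip: of_real_mult of_real_diff)
    qed
    moreover have "c = (1 / z + 1 / w) * b - 1 / z * (1 / w) * a"
      if "z * w * c = (z + w) * b - a" for a b c
    proof -
      have "c = ((z + w) * b - a) / (z * w)" using that nz by (metis mult_eq_0_iff nonzero_mult_div_cancel_left)
      also have "\<dots> = (1 / z + 1 / w) * b - 1 / z * (1 / w) * a"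
        using nz by (simp add: field_simps)
      finally show ?thesis .
    qed
    ultimately have "?a (Suc (Suc n)) = (1 / z + 1 / w) * ?a (Suc n) - 1 / z * (1 / w) * ?a n" for n
      by blast
    then have "summable (\<lambda>n. cmod (?a n))"
      by (rule summable_second_order_recurrence) (use zw in \<open>simp_all add: norm_divide divide_less_eq\<close>)
    then show ?thesis by simp
  qed
  have "summable (\<lambda>n. \<Sum>i\<in>UNIV. \<bar>?x n $ i\<bar>)" by (intro summable_sum coord)
  then show ?thesis
    by (rule summable_comparison_test'[where N = 0]) (simp only: real_norm_def abs_norm_cancel norm_le_l1_cart)
qed

section \<open>Existence and uniqueness of the invariant law\<close>

text \<open>The defining equation of \<^const>\<open>is_self_affine_measure\<close> for an arbitrary linear part \<open>f\<close> in place
  of an inverse matrix.\<close>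

definition invariant_law :: "('a::euclidean_space \<Rightarrow> 'a) \<Rightarrow> 'a set \<Rightarrow> 'a measure \<Rightarrow> bool" where
  "invariant_law f D \<mu> \<longleftrightarrow> prob_space \<mu> \<and> sets \<mu> = sets borel \<and>
     (\<forall>E\<in>sets borel. measure \<mu> E = (\<Sum>d\<in>D. measure \<mu> ((\<lambda>x. f (x + d)) -` E)) / real (card D))"

text \<open>Summability of orbits replaces a contraction hypothesis \<open>norm (f x) \<le> q * norm x\<close>: the inverse of an
  expanding matrix need not be a contraction for the Euclidean norm.\<close>

locale contracting_ifs =
  fixes f :: "'a::euclidean_space \<Rightarrow> 'a" and D :: "'a set"
  assumes bounded_linear_f: "bounded_linear f"
    and summable_orbit: "\<And>v. summable (\<lambda>n. norm ((f ^^ n) v))"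
    and finite_D: "finite D" and D_nonempty: "D \<noteq> {}"
begin

lemma borel_measurable_f [measurable]: "f \<in> borel_measurable borel"
  using bounded_linear_f by (intro borel_measurable_continuous_onI linear_continuous_on)

lemma shift_vimage_in_borel:
  assumes "E \<in> sets borel"
  shows "(\<lambda>x. f (x + d)) -` E \<in> sets borel"
proof -
  have "(\<lambda>x. f (x + d)) \<in> borel_measurable borel" by measurable
  from measurable_sets[OF this assms] show ?thesis by simp
qed

lemma bounded_linear_funpow: "bounded_linear (f ^^ n)"
proof (induction n)
  case 0
  show ?case by (simp add: id_def bounded_linear_ident)
next
  case (Suc n)
  then show ?case
    using bounded_linear_compose[OF bounded_linear_f Suc] by (simp add: o_def)
qed

lemma funpow_tendsto_0: "(\<lambda>n. (f ^^ n) v) \<longlonglongrightarrow> 0"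
  using summable_LIMSEQ_zero[OF summable_orbit] by (simp add: tendsto_norm_zero_iff)

lemma card_D_pos: "0 < card D"
  using finite_D D_nonempty by (simp add: card_gt_0_iff)

text \<open>Invariance says that \<open>\<mu>\<close> is the image of the product of the uniform law on the digits with \<open>\<mu>\<close>
  under \<open>(d, x) \<mapsto> f (x + d)\<close>.\<close>

lemma integral_invariant_law:
  fixes h :: "'a \<Rightarrow> 'b::{banach, second_countable_topology}"
  assumes \<mu>: "invariant_law f D \<mu>"
    and [measurable]: "h \<in> borel_measurable borel" and bnd: "\<And>x. norm (h x) \<le> K"
  shows "(\<integral>x. h x \<partial>\<mu>) = (\<Sum>d\<in>D. \<integral>x. h (f (x + d)) \<partial>\<mu>) /\<^sub>R real (card D)"
proof -
  let ?U = "uniform_count_measure D"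
  interpret U: prob_space ?U
    by (rule prob_space_uniform_count_measure) (use finite_D D_nonempty in auto)
  interpret \<mu>: prob_space \<mu> using \<mu> by (simp add: invariant_law_def)
  have [measurable_cong]: "sets \<mu> = sets borel" using \<mu> by (simp add: invariant_law_def)
  interpret UM: pair_prob_space ?U \<mu> ..
  have [measurable]: "(\<lambda>d. d) \<in> borel_measurable ?U"
    by (auto simp: measurable_def sets_uniform_count_measure space_uniform_count_measure)
  \<comment> \<open>Invariance only concerns indicators. Fubini's theorem for these identifies the image \<open>\<kappa>\<close> of the
    product with \<open>\<mu>\<close>, and then applies to \<open>h\<close>.\<close>
  define \<kappa> where "\<kappa> = distr (?U \<Otimes>\<^sub>M \<mu>) borel (\<lambda>p. f (snd p + fst p))"
  have fst_borel [measurable]: "fst \<in> borel_measurable (?U \<Otimes>\<^sub>M \<mu>)"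
    by (rule measurable_compose[OF measurable_fst]) measurable
  have meas [measurable]: "(\<lambda>p. f (snd p + fst p)) \<in> borel_measurable (?U \<Otimes>\<^sub>M \<mu>)"
    by measurable
  have \<kappa>: "(\<integral>x. k x \<partial>\<kappa>) = (\<Sum>d\<in>D. \<integral>x. k (f (x + d)) \<partial>\<mu>) /\<^sub>R real (card D)"
    if [measurable]: "k \<in> borel_measurable borel" and "\<And>x. norm (k x) \<le> C"
    for k :: "'a \<Rightarrow> 'c::{banach, second_countable_topology}" and C
  proof -
    have "integrable (?U \<Otimes>\<^sub>M \<mu>) (\<lambda>p. k (f (snd p + fst p)))"
      using that(2) by (intro UM.P.integrable_const_bound[where B = C]) auto
    then have "(\<integral>p. k (f (snd p + fst p)) \<partial>(?U \<Otimes>\<^sub>M \<mu>))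
        = (\<integral>d. (\<integral>x. k (f (x + d)) \<partial>\<mu>) \<partial>?U)"
      by (subst UM.integral_fst'[symmetric]) simp_all
    also have "\<dots> = (\<Sum>d\<in>D. \<integral>x. k (f (x + d)) \<partial>\<mu>) /\<^sub>R real (card D)"
      using finite_D
      by (simp add: uniform_count_measure_def lebesgue_integral_point_measure_finite
          scaleR_sum_right inverse_eq_divide)
    finally show ?thesis by (simp add: \<kappa>_def integral_distr)
  qed
  interpret \<kappa>: prob_space \<kappa>
    unfolding \<kappa>_def by (rule UM.P.prob_space_distr) measurable
  have "\<kappa> = \<mu>"
  proof (rule measure_eqI)
    show "sets \<kappa> = sets \<mu>" using \<mu> by (simp add: \<kappa>_def invariant_law_def)
    fix E assume "E \<in> sets \<kappa>"
    then have E [measurable]: "E \<in> sets borel" by (simp add: \<kappa>_def)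
    have "measure \<kappa> E = (\<integral>x. indicator E x \<partial>\<kappa>)"
      using E by (simp add: \<kappa>_def)
    also have "\<dots> = (\<Sum>d\<in>D. \<integral>x. indicator E (f (x + d)) \<partial>\<mu>) / real (card D)"
      by (subst \<kappa>[of "indicator E" 1]) (simp_all add: indicator_def divide_inverse_commute)
    also have "(\<lambda>d. \<integral>x. indicator E (f (x + d)) \<partial>\<mu>) = (\<lambda>d. measure \<mu> ((\<lambda>x. f (x + d)) -` E))"
    proof
      fix d
      have "(\<lambda>x. f (x + d)) -` E \<in> sets \<mu>"
        using shift_vimage_in_borel[OF E] \<mu> by (simp add: invariant_law_def)
      moreover have "(\<lambda>x. indicator E (f (x + d)) :: real) = indicator ((\<lambda>x. f (x + d)) -` E)"
        by (auto simp: indicator_def)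
      ultimately show "(\<integral>x. indicator E (f (x + d)) \<partial>\<mu>) = measure \<mu> ((\<lambda>x. f (x + d)) -` E)"
        by simp
    qed
    also have "(\<Sum>d\<in>D. measure \<mu> ((\<lambda>x. f (x + d)) -` E)) / real (card D) = measure \<mu> E"
      using \<mu> E by (simp add: invariant_law_def)
    finally show "emeasure \<kappa> E = emeasure \<mu> E"
      by (simp add: \<kappa>.emeasure_eq_measure \<mu>.emeasure_eq_measure)
  qed
  then show ?thesis using \<kappa>[of h K] bnd by simp
qed

text \<open>The dual of the averaging operator on measures of which an invariant law is a fixed point: it leaves
  integrals against invariant laws unchanged.\<close>

definition transfer :: "('a \<Rightarrow> real) \<Rightarrow> 'a \<Rightarrow> real" where
  "transfer g x = (\<Sum>d\<in>D. g (f (x + d))) / real (card D)"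

text \<open>All maps \<open>x \<mapsto> f (x + d)\<close> have the same linear part, so the images of \<open>x\<close> and \<open>y\<close> under
  any one of them differ by \<open>f (x - y)\<close>. A modulus \<open>h\<close> of the difference vector, rather than a Lipschitz constant, is what
  can be iterated here.\<close>

lemma transfer_difference_bound:
  assumes "\<And>x y. \<bar>g x - g y\<bar> \<le> h (x - y)"
  shows "\<bar>transfer g x - transfer g y\<bar> \<le> h (f (x - y))"
proof -
  interpret bounded_linear f by (rule bounded_linear_f)
  have *: "f (x + d) - f (y + d) = f (x - y)" for d
    by (simp flip: diff)
  have "\<bar>transfer g x - transfer g y\<bar> = \<bar>\<Sum>d\<in>D. g (f (x + d)) - g (f (y + d))\<bar> / real (card D)"
    by (simp add: transfer_def sum_subtractf flip: diff_divide_distrib)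
  also have "\<dots> \<le> (\<Sum>d\<in>D. h (f (x - y))) / real (card D)"
    using assms[of "f (x + d)" "f (y + d)" for d]
    by (intro divide_right_mono order_trans[OF sum_abs] sum_mono) (auto simp: *)
  also have "\<dots> = h (f (x - y))" using card_D_pos by simp
  finally show ?thesis .
qed

lemma transfer_funpow_lipschitz:
  assumes "\<And>x y. \<bar>g x - g y\<bar> \<le> L * norm (x - y)"
  shows "\<bar>(transfer ^^ n) g x - (transfer ^^ n) g y\<bar> \<le> L * norm ((f ^^ n) (x - y))"
proof (induction n arbitrary: x y)
  case (Suc n)
  show ?case
    using transfer_difference_bound[of "(transfer ^^ n) g" "\<lambda>v. L * norm ((f ^^ n) v)", OF Suc]
    by (simp add: funpow_swap1)
qed (use assms in simp)

lemma transfer_funpow_bounded: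
  assumes "\<And>x. \<bar>g x\<bar> \<le> K"
  shows "\<bar>(transfer ^^ n) g x\<bar> \<le> K"
proof (induction n arbitrary: x)
  case (Suc n)
  have "\<bar>transfer h x\<bar> \<le> K" if "\<And>y. \<bar>h y\<bar> \<le> K" for h
  proof -
    have "\<bar>transfer h x\<bar> \<le> (\<Sum>d\<in>D. K) / real (card D)"
      unfolding transfer_def abs_divide abs_of_nat
      by (intro divide_right_mono order_trans[OF sum_abs] sum_mono that) simp
    then show ?thesis using card_D_pos by simp
  qed
  from this[OF Suc] show ?case by simp
qed (use assms in simp)

lemma borel_measurable_transfer_funpow:
  assumes [measurable]: "g \<in> borel_measurable borel"
  shows "(transfer ^^ n) g \<in> borel_measurable borel"
proof (induction n)
  case (Suc n)
  have "transfer h \<in> borel_measurable borel" if [measurable]: "h \<in> borel_measurable borel" for h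
    unfolding transfer_def by measurable
  from this[OF Suc] show ?case by simp
qed simp

lemma integral_transfer_funpow:
  assumes \<mu>: "invariant_law f D \<mu>" and g: "g \<in> borel_measurable borel" and bnd: "\<And>x. \<bar>g x\<bar> \<le> K"
  shows "(\<integral>x. (transfer ^^ n) g x \<partial>\<mu>) = (\<integral>x. g x \<partial>\<mu>)"
proof (induction n)
  case (Suc n)
  interpret \<mu>: prob_space \<mu> using \<mu> by (simp add: invariant_law_def)
  have [measurable_cong]: "sets \<mu> = sets borel" using \<mu> by (simp add: invariant_law_def)
  let ?h = "(transfer ^^ n) g"
  have [measurable]: "?h \<in> borel_measurable borel" 
    using g by (rule borel_measurable_transfer_funpow)
  have h: "\<bar>?h x\<bar> \<le> K" for x using bnd by (rule transfer_funpow_bounded)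
  have "integrable \<mu> (\<lambda>x. ?h (f (x + d)))" for d
    using h by (intro \<mu>.integrable_const_bound[where B = K]) auto
  then have "(\<integral>x. transfer ?h x \<partial>\<mu>) = (\<Sum>d\<in>D. \<integral>x. ?h (f (x + d)) \<partial>\<mu>) / real (card D)"
    by (simp add: transfer_def)
  also have "\<dots> = (\<integral>x. ?h x \<partial>\<mu>)"
    using integral_invariant_law[OF \<mu>, of ?h K] h by (simp add: divide_inverse_commute)
  finally show ?case using Suc by simp
qed simp

text \<open>The iterates of the transfer operator keep the integral of \<open>g\<close> but flatten \<open>g\<close> to a constant, so
  their value at the single point 0 converges to the integral. The left-hand side does not mention \<open>\<mu>\<close>,
  which makes the integral the same for all invariant laws.\<close>

lemma transfer_funpow_tendsto_integral:
  assumes \<mu>: "invariant_law f D \<mu>"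
    and lip: "\<And>x y. \<bar>g x - g y\<bar> \<le> L * norm (x - y)" and bnd: "\<And>x. \<bar>g x\<bar> \<le> K"
  shows "(\<lambda>n. (transfer ^^ n) g 0) \<longlonglongrightarrow> (\<integral>x. g x \<partial>\<mu>)"
proof -
  interpret \<mu>: prob_space \<mu> using \<mu> by (simp add: invariant_law_def)
  have [measurable_cong]: "sets \<mu> = sets borel" using \<mu> by (simp add: invariant_law_def)
  have "\<bar>L\<bar>-lipschitz_on UNIV g"
  proof (rule lipschitz_onI)
    fix x y :: 'a
    have "L * norm (x - y) \<le> \<bar>L\<bar> * norm (x - y)" by (intro mult_right_mono) auto
    then show "dist (g x) (g y) \<le> \<bar>L\<bar> * dist x y"
      using lip[of x y] by (simp add: dist_norm)
  qed simp
  then have g [measurable]: "g \<in> borel_measurable borel"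
    by (intro borel_measurable_continuous_onI lipschitz_on_continuous_on)
  have [measurable]: "(transfer ^^ n) g \<in> borel_measurable borel" for n
    using g by (rule borel_measurable_transfer_funpow)
  have T: "\<bar>(transfer ^^ n) g x\<bar> \<le> K" for n x using bnd by (rule transfer_funpow_bounded)
  have "(\<lambda>n. \<integral>x. (transfer ^^ n) g x - (transfer ^^ n) g 0 \<partial>\<mu>) \<longlonglongrightarrow> (\<integral>x. 0 \<partial>\<mu>)"
  proof (rule integral_dominated_convergence[where w = "\<lambda>_. 2 * K"])
    show "AE x in \<mu>. (\<lambda>n. (transfer ^^ n) g x - (transfer ^^ n) g 0) \<longlonglongrightarrow> 0"
    proof (rule AE_I2)
      fix x
      have "(\<lambda>n. L * norm ((f ^^ n) x)) \<longlonglongrightarrow> L * norm (0::'a)"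
        by (intro tendsto_intros funpow_tendsto_0)
      then have lim: "(\<lambda>n. L * norm ((f ^^ n) x)) \<longlonglongrightarrow> 0" by simp
      show "(\<lambda>n. (transfer ^^ n) g x - (transfer ^^ n) g 0) \<longlonglongrightarrow> 0"
        by (rule Lim_null_comparison[OF _ lim])
           (use transfer_funpow_lipschitz[OF lip, where y = 0] in simp)
    qed
    show "AE x in \<mu>. norm ((transfer ^^ n) g x - (transfer ^^ n) g 0) \<le> 2 * K" for n
      using T[of n] by (intro AE_I2) (smt (verit) real_norm_def)
  qed auto
  moreover have "(\<integral>x. (transfer ^^ n) g x - (transfer ^^ n) g 0 \<partial>\<mu>)
      = (\<integral>x. g x \<partial>\<mu>) - (transfer ^^ n) g 0" for n
  proof -
    have "integrable \<mu> ((transfer ^^ n) g)"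
      using T by (intro \<mu>.integrable_const_bound[where B = K]) auto
    then show ?thesis
      using integral_transfer_funpow[OF \<mu> g bnd, of n] by (simp add: \<mu>.prob_space)
  qed
  ultimately have "(\<lambda>n. (\<integral>x. g x \<partial>\<mu>) - (transfer ^^ n) g 0) \<longlonglongrightarrow> 0" by simp
  from tendsto_diff[OF tendsto_const[of "\<integral>x. g x \<partial>\<mu>"] this] show ?thesis by simp
qed

text \<open>Indicators of closed sets are limits of the Lipschitz functions \<open>max 0 (1 - k * infdist x C)\<close>, on whose
  integrals any two invariant laws agree; closed sets are an intersection-stable generator of the
  Borel sets.\<close>

lemma invariant_law_unique:
  assumes \<mu>: "invariant_law f D \<mu>" and \<nu>: "invariant_law f D \<nu>"
  shows "\<mu> = \<nu>"
proof (rule measure_eqI_generator_eq[of "Collect closed" UNIV _ _ "\<lambda>_. UNIV"])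
  interpret \<mu>: prob_space \<mu> using \<mu> by (simp add: invariant_law_def)
  interpret \<nu>: prob_space \<nu> using \<nu> by (simp add: invariant_law_def)
  show "Int_stable (Collect (closed :: 'a set \<Rightarrow> bool))" by (auto simp: Int_stable_def)
  have sets: "sets \<mu> = sets borel" "sets \<nu> = sets borel"
    using \<mu> \<nu> by (auto simp: invariant_law_def)
  have "sets (borel :: 'a measure) = sigma_sets UNIV (Collect closed)"
    by (subst borel_eq_closed) simp
  with sets show "sets \<mu> = sigma_sets UNIV (Collect closed)"
      "sets \<nu> = sigma_sets UNIV (Collect closed)" by auto
  show "emeasure \<mu> UNIV \<noteq> \<infinity>" by simp
  fix C :: "'a set" assume "C \<in> Collect closed"
  then have "closed C" by simp
  show "emeasure \<mu> C = emeasure \<nu> C"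
  proof (cases "C = {}")
    case False
    define g where "g k x = max 0 (1 - real k * infdist x C)" for k x
    have lip: "\<bar>g k x - g k y\<bar> \<le> real k * norm (x - y)" for k x y
    proof -
      have "\<bar>g k x - g k y\<bar> \<le> \<bar>real k * infdist x C - real k * infdist y C\<bar>"
        unfolding g_def by (auto simp: max_def)
      also have "\<dots> = real k * \<bar>infdist x C - infdist y C\<bar>"
        by (simp add: abs_mult flip: right_diff_distrib)
      also have "\<dots> \<le> real k * norm (x - y)"
        using infdist_triangle_abs[of x C y] by (intro mult_left_mono) (auto simp: dist_norm)
      finally show ?thesis .
    qed
    have bnd: "\<bar>g k x\<bar> \<le> 1" for k x
      by (auto simp: g_def infdist_nonneg)
    have lim: "(\<lambda>k. g k x) \<longlonglongrightarrow> indicator C x" for x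
    proof (cases "x \<in> C")
      case True
      then show ?thesis by (simp add: g_def)
    next
      case xC: False
      then have pos: "infdist x C > 0"
        using in_closed_iff_infdist_zero[OF \<open>closed C\<close> False] infdist_nonneg[of x C] by force
      obtain N where N: "real N > 1 / infdist x C" using reals_Archimedean2 by blast
      have "g k x = 0" if "k \<ge> N" for k
      proof -
        have "1 < real N * infdist x C" using N pos by (simp add: divide_less_eq)
        also have "\<dots> \<le> real k * infdist x C" using that pos by simp
        finally show ?thesis by (simp add: g_def)
      qed
      then show ?thesis using xC
        by (intro tendsto_eventually) (auto simp: eventually_sequentially)
    qed
    have [measurable]: "g k \<in> borel_measurable borel" for k
      unfolding g_def by (intro borel_measurable_continuous_onI continuous_intros)
    have conv: "(\<lambda>k. \<integral>x. g k x \<partial>M) \<longlonglongrightarrow> measure M C"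
      if "prob_space M" and M [measurable_cong]: "sets M = sets borel" for M
    proof -
      interpret M: prob_space M by fact
      have [measurable]: "C \<in> sets M" using \<open>closed C\<close> M by simp
      have "(\<lambda>k. \<integral>x. g k x \<partial>M) \<longlonglongrightarrow> (\<integral>x. indicator C x \<partial>M)"
        using lim bnd by (intro integral_dominated_convergence[where w = "\<lambda>_. 1"]) auto
      then show ?thesis by simp
    qed
    have "(\<integral>x. g k x \<partial>\<mu>) = (\<integral>x. g k x \<partial>\<nu>)" for k
      using transfer_funpow_tendsto_integral[OF \<mu> lip bnd, of k]
        transfer_funpow_tendsto_integral[OF \<nu> lip bnd, of k]
      by (rule LIMSEQ_unique)
    then have "measure \<mu> C = measure \<nu> C"
      using conv[OF \<mu>.prob_space_axioms sets(1)] conv[OF \<nu>.prob_space_axioms sets(2)]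
      by (simp add: LIMSEQ_unique)
    then show ?thesis by (simp add: \<mu>.emeasure_eq_measure \<nu>.emeasure_eq_measure)
  qed simp
qed auto

text \<open>The point with digit expansion \<open>\<omega>\<close>, the analogue of \<open>0.d\<^sub>0d\<^sub>1d\<^sub>2\<dots>\<close> in base \<open>f\<inverse>\<close>.\<close>

definition coding :: "'a stream \<Rightarrow> 'a" where
  "coding \<omega> = (\<Sum>n. (f ^^ Suc n) (\<omega> !! n))"

lemma summable_coding:
  assumes "\<omega> \<in> streams D"
  shows "summable (\<lambda>n. (f ^^ Suc n) (\<omega> !! n))"
proof (rule summable_comparison_test)
  show "summable (\<lambda>n. \<Sum>d\<in>D. norm ((f ^^ Suc n) d))"
    by (intro summable_sum summable_Suc_iff[THEN iffD2] summable_orbit)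
  have "norm ((f ^^ Suc n) (\<omega> !! n)) \<le> (\<Sum>d\<in>D. norm ((f ^^ Suc n) d))" for n
    using finite_D assms by (intro member_le_sum) (auto simp: streams_iff_snth)
  then show "\<exists>N. \<forall>n\<ge>N. norm ((f ^^ Suc n) (\<omega> !! n)) \<le> (\<Sum>d\<in>D. norm ((f ^^ Suc n) d))"
    by blast
qed

lemma coding_Stream:
  assumes "\<omega> \<in> streams D" "d \<in> D"
  shows "coding (d ## \<omega>) = f (coding \<omega> + d)"
proof -
  interpret bounded_linear f by (rule bounded_linear_f)
  have "d ## \<omega> \<in> streams D" using assms by (simp add: streams_Stream)
  from suminf_split_head[OF summable_coding[OF this]]
  have "coding (d ## \<omega>) = f d + (\<Sum>n. f ((f ^^ Suc n) (\<omega> !! n)))"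
    by (simp add: coding_def)
  also have "(\<Sum>n. f ((f ^^ Suc n) (\<omega> !! n))) = f (coding \<omega>)"
    unfolding coding_def using suminf[OF summable_coding[OF assms(1)]] by simp
  finally show ?thesis by (simp add: add)
qed

text \<open>The law of \<^const>\<open>coding\<close> for independent uniform digits is invariant, because prepending a digit
  \<open>d\<close> to the stream acts on its value as \<open>x \<mapsto> f (x + d)\<close>.\<close>

lemma invariant_law_exists: "\<exists>\<mu>. invariant_law f D \<mu>"
proof -
  let ?U = "uniform_count_measure D"
  interpret U: prob_space ?U
    by (rule prob_space_uniform_count_measure) (use finite_D D_nonempty in auto)
  let ?S = "stream_space ?U"
  interpret S: prob_space ?S by (rule U.prob_space_stream_space)
  have any [measurable]: "g \<in> borel_measurable ?U" for g :: "'a \<Rightarrow> 'a"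
    by (auto simp: measurable_def sets_uniform_count_measure space_uniform_count_measure)
  have coding [measurable]: "coding \<in> borel_measurable ?S"
    unfolding coding_def
    by (intro borel_measurable_suminf measurable_compose[OF measurable_snth any])
  let ?\<mu> = "distr ?S borel coding"
  interpret \<mu>: prob_space ?\<mu> by (rule S.prob_space_distr) measurable
  have "measure ?\<mu> E = (\<Sum>d\<in>D. measure ?\<mu> ((\<lambda>x. f (x + d)) -` E)) / real (card D)"
    if E [measurable]: "E \<in> sets borel" for E
  proof -
    have "emeasure ?\<mu> E = emeasure ?S (coding -` E \<inter> space ?S)"
      by (simp add: emeasure_distr)
    also have "\<dots> = (\<integral>\<^sup>+d. emeasure ?S {\<omega>\<in>space ?S. d ## \<omega> \<in> coding -` E \<inter> space ?S} \<partial>?U)"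
      by (rule U.emeasure_stream_space) measurable
    also have "\<dots> = (\<integral>\<^sup>+d. emeasure ?\<mu> ((\<lambda>x. f (x + d)) -` E) \<partial>?U)"
    proof (rule nn_integral_cong)
      fix d assume "d \<in> space ?U"
      then have d: "d \<in> D" by (simp add: space_uniform_count_measure)
      have m: "(\<lambda>x. f (x + d)) -` E \<in> sets borel" by (rule shift_vimage_in_borel[OF E])
      have "{\<omega>\<in>space ?S. d ## \<omega> \<in> coding -` E \<inter> space ?S}
          = coding -` ((\<lambda>x. f (x + d)) -` E) \<inter> space ?S"
        using d by (auto simp: space_stream_space space_uniform_count_measure coding_Stream
            streams_Stream)
      then show "emeasure ?S {\<omega>\<in>space ?S. d ## \<omega> \<in> coding -` E \<inter> space ?S}
          = emeasure ?\<mu> ((\<lambda>x. f (x + d)) -` E)"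
        using m by (simp add: emeasure_distr)
    qed
    also have "\<dots> = (\<Sum>d\<in>D. ennreal (measure ?\<mu> ((\<lambda>x. f (x + d)) -` E) / real (card D)))"
    proof -
      have "(\<integral>\<^sup>+d. h d \<partial>?U) = (\<Sum>d\<in>D. ennreal (1 / real (card D)) * h d)" for h
        using finite_D by (simp add: uniform_count_measure_def nn_integral_point_measure_finite)
      then show ?thesis by (simp add: \<mu>.emeasure_eq_measure flip: ennreal_mult)
    qed
    also have "\<dots> = ennreal ((\<Sum>d\<in>D. measure ?\<mu> ((\<lambda>x. f (x + d)) -` E)) / real (card D))"
      by (simp add: sum_ennreal sum_divide_distrib)
    finally show ?thesis
      by (simp add: \<mu>.emeasure_eq_measure sum_nonneg)
  qed
  then have "invariant_law f D ?\<mu>"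
    using \<mu>.prob_space_axioms by (simp add: invariant_law_def)
  then show ?thesis ..
qed

end

section \<open>Zeros of the Fourier transform\<close>

definition circle_exp :: "real \<Rightarrow> complex" where
  "circle_exp t = cis (2 * pi * t)"

lemma circle_exp_0 [simp]: "circle_exp 0 = 1"
  by (simp add: circle_exp_def)

lemma norm_circle_exp [simp]: "norm (circle_exp t) = 1"
  by (simp add: circle_exp_def)

lemma circle_exp_add: "circle_exp (s + t) = circle_exp s * circle_exp t"
  by (simp add: circle_exp_def cis_mult distrib_left)

lemma circle_exp_minus: "circle_exp (- t) = cnj (circle_exp t)"
  by (simp add: circle_exp_def cis_cnj)

lemma circle_exp_eq_1_iff: "circle_exp t = 1 \<longleftrightarrow> (\<exists>n::int. t = of_int n)"
proof -
  have "circle_exp t = exp (\<i> * complex_of_real (2 * pi * t))"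
    by (simp add: circle_exp_def cis_conv_exp)
  also have "\<dots> = 1 \<longleftrightarrow> (\<exists>n::int. t = of_int n)"
    by (subst exp_eq_1) simp
  finally show ?thesis .
qed

lemma continuous_on_circle_exp [continuous_intros]:
  "continuous_on A g \<Longrightarrow> continuous_on A (\<lambda>x. circle_exp (g x))"
  unfolding circle_exp_def cis_conv_exp by (intro continuous_intros)

text \<open>If \<open>1 + P + Q = 0\<close> with \<open>P, Q\<close> on the unit circle, then multiplying the conjugate equation by \<open>P Q\<close>
  gives \<open>P Q + Q + P = 0\<close>, whence \<open>P Q = 1\<close> and \<open>P\<close> is a primitive cube root of unity with inverse \<open>Q\<close>.
  Phrasing this by the integers \<open>p = 3 x\<close> and \<open>q = 3 y\<close> treats both primitive roots at once.\<close>

lemma cube_root_sum_eq_0_iff: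
  "1 + circle_exp x + circle_exp y = 0 \<longleftrightarrow>
     (\<exists>p q :: int. 3 * x = of_int p \<and> 3 * y = of_int q \<and> \<not> 3 dvd p \<and> 3 dvd p + q)"
proof -
  let ?P = "circle_exp x" and ?Q = "circle_exp y"
  have unit: "circle_exp t * cnj (circle_exp t) = 1" for t
    by (simp add: circle_exp_def cis_cnj cis_mult)
  have P3: "circle_exp (3 * x) = ?P ^ 3"
    using circle_exp_add[of x x] circle_exp_add[of "x + x" x] by (simp add: power3_eq_cube)
  have factor: "?P ^ 3 - 1 = (?P - 1) * (?P\<^sup>2 + ?P + 1)"
    by (simp add: power3_eq_cube power2_eq_square algebra_simps)
  show ?thesis
  proof
    assume sum: "1 + ?P + ?Q = 0"
    have "?P * ?Q * cnj (1 + ?P + ?Q) = ?P * ?Q + ?Q * (?P * cnj ?P) + ?P * (?Q * cnj ?Q)"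
      by (simp add: algebra_simps)
    also have "\<dots> = ?P * ?Q + ?Q + ?P" by (simp only: unit mult_1_right)
    finally have sum': "?P * ?Q + ?Q + ?P = 0" using sum by simp
    have Q: "?Q = - 1 - ?P" using sum by (simp add: algebra_simps eq_neg_iff_add_eq_0)
    have "?P * ?Q = (?P * ?Q + ?Q + ?P) - (1 + ?P + ?Q) + 1" by simp
    also have "\<dots> = 1" unfolding sum sum' by simp
    finally have PQ: "?P * ?Q = 1" .
    then have "circle_exp (x + y) = 1" by (simp add: circle_exp_add)
    then obtain m where m: "x + y = of_int m" by (auto simp: circle_exp_eq_1_iff)
    have "?P\<^sup>2 + ?P + 1 = 1 - ?P * (- 1 - ?P)" by (simp add: power2_eq_square algebra_simps)
    also have "\<dots> = 0" using PQ unfolding Q by simp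
    finally have P2: "?P\<^sup>2 + ?P + 1 = 0" .
    have "circle_exp (3 * x) = 1" using P2 factor P3 by simp
    then obtain p where p: "3 * x = of_int p" by (auto simp: circle_exp_eq_1_iff)
    have "\<not> 3 dvd p"
    proof
      assume "3 dvd p"
      then obtain k where "p = 3 * k" by auto
      then have "x = of_int k" using p by simp
      then have "?P = 1" by (auto simp: circle_exp_eq_1_iff)
      then show False using P2 by simp
    qed
    moreover have "3 * y = of_int (3 * m - p)" using m p by simp
    ultimately show "\<exists>p q :: int. 3 * x = of_int p \<and> 3 * y = of_int q \<and> \<not> 3 dvd p \<and> 3 dvd p + q"
      using p by (intro exI[of _ p] exI[of _ "3 * m - p"]) simp
  next
    assume "\<exists>p q :: int. 3 * x = of_int p \<and> 3 * y = of_int q \<and> \<not> 3 dvd p \<and> 3 dvd p + q"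
    then obtain p q :: int where pq: "3 * x = of_int p" "3 * y = of_int q" "\<not> 3 dvd p" "3 dvd p + q"
      by blast
    have "?P \<noteq> 1"
    proof
      assume "?P = 1"
      then obtain k where "x = of_int k" by (auto simp: circle_exp_eq_1_iff)
      then have "real_of_int p = of_int (3 * k)" using pq(1) by simp
      then have "p = 3 * k" by (simp only: of_int_eq_iff)
      with pq(3) show False by simp
    qed
    moreover have "circle_exp (3 * x) = 1" unfolding pq(1) by (auto simp: circle_exp_eq_1_iff)
    ultimately have P: "?P\<^sup>2 + ?P + 1 = 0" using factor P3 by simp
    obtain m where "p + q = 3 * m" using pq(4) by auto
    then have "real_of_int p + of_int q = 3 * of_int m" by (metis of_int_add of_int_mult of_int_numeral)
    then have "x + y = of_int m" using pq(1,2) by simp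
    then have PQ: "?P * ?Q = 1"
      by (auto simp: circle_exp_add[symmetric] circle_exp_eq_1_iff)
    have "?P * (1 + ?P + ?Q) = ?P\<^sup>2 + ?P + ?P * ?Q" by (simp add: algebra_simps power2_eq_square)
    also have "\<dots> = 0" using P PQ by simp
    finally have "?P = 0 \<or> 1 + ?P + ?Q = 0" by (simp only: mult_eq_0_iff)
    moreover have "?P \<noteq> 0" by (metis norm_circle_exp norm_zero zero_neq_one)
    ultimately show "1 + ?P + ?Q = 0" by blast
  qed
qed

context contracting_ifs
begin

lemma fourier_step:
  assumes \<mu>: "invariant_law f D \<mu>"
  shows "(\<integral>x. circle_exp (\<xi> \<bullet> (f ^^ n) x) \<partial>\<mu>)
    = (\<Sum>d\<in>D. circle_exp (\<xi> \<bullet> (f ^^ Suc n) d)) /\<^sub>R real (card D)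
      * (\<integral>x. circle_exp (\<xi> \<bullet> (f ^^ Suc n) x) \<partial>\<mu>)"
proof -
  have "continuous_on UNIV (\<lambda>x. circle_exp (\<xi> \<bullet> (f ^^ n) x))"
    by (intro continuous_intros linear_continuous_on bounded_linear_funpow)
  then have m: "(\<lambda>x. circle_exp (\<xi> \<bullet> (f ^^ n) x)) \<in> borel_measurable borel"
    by (rule borel_measurable_continuous_onI)
  have lin: "(f ^^ n) (f (x + d)) = (f ^^ Suc n) x + (f ^^ Suc n) d" for x d
    using linear_add[OF bounded_linear.linear[OF bounded_linear_funpow[of "Suc n"]], of x d]
    by (simp add: funpow_swap1)
  have "(\<integral>x. circle_exp (\<xi> \<bullet> (f ^^ n) x) \<partial>\<mu>)
      = (\<Sum>d\<in>D. \<integral>x. circle_exp (\<xi> \<bullet> (f ^^ n) (f (x + d))) \<partial>\<mu>) /\<^sub>R real (card D)"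
    by (rule integral_invariant_law[OF \<mu> m, of 1]) simp
  also have "(\<lambda>d. \<integral>x. circle_exp (\<xi> \<bullet> (f ^^ n) (f (x + d))) \<partial>\<mu>)
      = (\<lambda>d. circle_exp (\<xi> \<bullet> (f ^^ Suc n) d) * (\<integral>x. circle_exp (\<xi> \<bullet> (f ^^ Suc n) x) \<partial>\<mu>))"
    unfolding lin inner_add_right circle_exp_add
    by (subst integral_mult_right_zero[symmetric]) (simp only: mult.commute)
  finally show ?thesis by (simp only: sum_distrib_right mult_scaleR_left)
qed

lemma fourier_tendsto_1:
  assumes \<mu>: "invariant_law f D \<mu>"
  shows "(\<lambda>n. \<integral>x. circle_exp (\<xi> \<bullet> (f ^^ n) x) \<partial>\<mu>) \<longlonglongrightarrow> 1"
proof -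
  interpret \<mu>: prob_space \<mu> using \<mu> by (simp add: invariant_law_def)
  have [measurable_cong]: "sets \<mu> = sets borel" using \<mu> by (simp add: invariant_law_def)
  have "continuous_on UNIV (\<lambda>x. circle_exp (\<xi> \<bullet> (f ^^ n) x))" for n
    by (intro continuous_intros linear_continuous_on bounded_linear_funpow)
  then have [measurable]: "(\<lambda>x. circle_exp (\<xi> \<bullet> (f ^^ n) x)) \<in> borel_measurable borel" for n
    by (rule borel_measurable_continuous_onI)
  have "(\<lambda>n. \<integral>x. circle_exp (\<xi> \<bullet> (f ^^ n) x) \<partial>\<mu>) \<longlonglongrightarrow> (\<integral>x. 1 \<partial>\<mu>)"
  proof (rule integral_dominated_convergence[where w = "\<lambda>_. 1"])
    show "AE x in \<mu>. (\<lambda>n. circle_exp (\<xi> \<bullet> (f ^^ n) x)) \<longlonglongrightarrow> 1"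
    proof (rule AE_I2)
      fix x
      have "isCont circle_exp 0"
        using continuous_on_circle_exp[OF continuous_on_id, of UNIV]
        by (simp add: continuous_on_eq_continuous_at)
      moreover have "(\<lambda>n. \<xi> \<bullet> (f ^^ n) x) \<longlonglongrightarrow> \<xi> \<bullet> 0"
        by (intro tendsto_intros funpow_tendsto_0)
      ultimately show "(\<lambda>n. circle_exp (\<xi> \<bullet> (f ^^ n) x)) \<longlonglongrightarrow> 1"
        using isCont_tendsto_compose[of 0 circle_exp] by fastforce
    qed
  qed auto
  then show ?thesis by (simp add: \<mu>.prob_space)
qed

text \<open>By \<open>fourier_step\<close> the transform is a finite product of digit sums times a remainder integral; the
  remainder tends to 1 and hence is eventually nonzero.\<close>

lemma fourier_eq_0_iff:
  assumes \<mu>: "invariant_law f D \<mu>"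
  shows "(\<integral>x. circle_exp (\<xi> \<bullet> x) \<partial>\<mu>) = 0 \<longleftrightarrow>
    (\<exists>n. (\<Sum>d\<in>D. circle_exp (\<xi> \<bullet> (f ^^ Suc n) d)) = 0)"
proof -
  let ?F = "\<lambda>n. \<integral>x. circle_exp (\<xi> \<bullet> (f ^^ n) x) \<partial>\<mu>"
  let ?m = "\<lambda>n. \<Sum>d\<in>D. circle_exp (\<xi> \<bullet> (f ^^ Suc n) d)"
  have step: "?F n = 0 \<longleftrightarrow> ?m n = 0 \<or> ?F (Suc n) = 0" for n
    using card_D_pos by (subst fourier_step[OF \<mu>]) simp
  have F0: "?F 0 = (\<integral>x. circle_exp (\<xi> \<bullet> x) \<partial>\<mu>)" by simp
  have "?F 0 = 0 \<longleftrightarrow> (\<exists>n. ?m n = 0)"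
  proof
    assume "?F 0 = 0"
    show "\<exists>n. ?m n = 0"
    proof (rule ccontr)
      assume "\<not> (\<exists>n. ?m n = 0)"
      then have nz: "?m n \<noteq> 0" for n by blast
      have "?F n = 0" for n
      proof (induction n)
        case 0
        show ?case by (rule \<open>?F 0 = 0\<close>)
      next
        case (Suc n)
        with step[of n] nz[of n] show ?case by blast
      qed
      then have "(\<lambda>n. 0) \<longlonglongrightarrow> (1::complex)" using fourier_tendsto_1[OF \<mu>, of \<xi>] by simp
      then show False by (simp add: LIMSEQ_const_iff)
    qed
  next
    assume "\<exists>n. ?m n = 0"
    then obtain n where "?m n = 0" ..
    then have "?F n = 0" using step by blast
    then show "?F 0 = 0"
    proof (induction n)
      case (Suc n)
      then show ?case using step by blast
    qed
  qed
  then show ?thesis unfolding F0 .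
qed

end

section \<open>Orbits of an integer matrix modulo 3\<close>

text \<open>The residue class modulo 3 as a value, so that residues can be counted; congruence of vectors is
  equality of their residues.\<close>

definition res3 :: "int^2 \<Rightarrow> int \<times> int" where
  "res3 v = (v $ 1 mod 3, v $ 2 mod 3)"

lemma res3_eq_iff: "res3 v = res3 w \<longleftrightarrow> 3 dvd (v $ 1 - w $ 1) \<and> 3 dvd (v $ 2 - w $ 2)"
  by (simp add: res3_def mod_eq_dvd_iff)

lemma res3_in: "res3 v \<in> {0..<3} \<times> {0..<3}"
  by (simp add: res3_def)

lemma res3_mult_cong:
  assumes "res3 v = res3 w"
  shows "res3 (N *v v) = res3 (N *v w)"
proof -
  have "(N *v v) $ i - (N *v w) $ i = N $ i $ 1 * (v $ 1 - w $ 1) + N $ i $ 2 * (v $ 2 - w $ 2)" for i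
    by (simp add: matrix_vector_mult_def sum_2 algebra_simps)
  with assms show ?thesis by (simp add: res3_eq_iff)
qed

lemma res3_funpow_cong:
  "res3 v = res3 w \<Longrightarrow> res3 (((*v) N ^^ n) v) = res3 (((*v) N ^^ n) w)"
  by (induction n) (simp_all, rule res3_mult_cong)

lemma res3_smult_cong:
  assumes "res3 v = res3 w"
  shows "res3 (c *s v) = res3 (c *s w)"
  using assms by (simp add: res3_eq_iff flip: right_diff_distrib)

lemma unit_mod_3:
  assumes "\<not> 3 dvd (x::int)"
  obtains s where "s \<in> {1, -1}" "3 dvd x - s"
proof -
  have "3 dvd x - 1 \<or> 3 dvd x - (-1)" using assms by presburger
  then show ?thesis using that[of 1] that[of "-1"] by auto
qed

lemma res3_mult_eq_0:
  assumes d: "\<not> 3 dvd det N" and v: "res3 (N *v v) = res3 0"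
  shows "res3 v = res3 0"
proof -
  have "det N * v $ 1 = N $ 2 $ 2 * (N *v v) $ 1 - N $ 1 $ 2 * (N *v v) $ 2"
       "det N * v $ 2 = N $ 1 $ 1 * (N *v v) $ 2 - N $ 2 $ 1 * (N *v v) $ 1"
    by (simp_all add: matrix_vector_mult_def sum_2 det_2 algebra_simps)
  moreover have "3 dvd (N *v v) $ 1" "3 dvd (N *v v) $ 2"
    using v by (simp_all add: res3_eq_iff)
  ultimately have "3 dvd det N * v $ 1" "3 dvd det N * v $ 2" by auto
  moreover have "prime (3::int)" by simp
  ultimately show ?thesis using d by (simp add: res3_eq_iff prime_dvd_mult_iff)
qed

lemma res3_funpow_eq_0:
  assumes "\<not> 3 dvd det N"
  shows "res3 (((*v) N ^^ n) v) = res3 0 \<Longrightarrow> res3 v = res3 0"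
  by (induction n) (auto dest: res3_mult_eq_0[OF assms])

text \<open>Cayley-Hamilton gives \<open>N\<^sup>3 = t N\<^sup>2 - d N\<close> for the trace \<open>t\<close> and determinant \<open>d\<close>. For \<open>t \<equiv> 0\<close> the
  right-hand side is \<open>-d N \<equiv> \<plusminus> N\<close>. For \<open>d \<equiv> 1\<close> and \<open>t \<equiv> \<plusminus>1\<close>, reducing \<open>N\<^sup>2\<close> once more leaves
  \<open>(t\<^sup>2 - d) N - t d \<equiv> -t\<close>.\<close>

lemma cube_returns_mod_3:
  fixes N :: "int^2^2"
  assumes d: "\<not> 3 dvd det N" and no: "\<not> (\<not> 3 dvd trace N \<and> 3 dvd det N + 1)"
  obtains s j where "s \<in> {1, -1}" "j < 3"
    "\<And>w. res3 (((*v) N ^^ 3) w) = res3 (s *s ((*v) N ^^ j) w)"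
proof (cases "3 dvd trace N")
  case True
  obtain s where s: "s \<in> {1, -1}" "3 dvd det N - s" using unit_mod_3[OF d] .
  have "res3 (((*v) N ^^ 3) w) = res3 ((- s) *s ((*v) N ^^ 1) w)" for w
  proof -
    have "((*v) N ^^ 3) w = trace N *s (N *v (N *v w)) - det N *s (N *v w)"
      using cayley_hamilton_2[of N "N *v w"] by (simp add: numeral_3_eq_3)
    then have "((*v) N ^^ 3) w $ i = trace N * (N *v (N *v w)) $ i - det N * (N *v w) $ i" for i
      by (simp only: vector_minus_component vector_smult_component)
    then have "((*v) N ^^ 3) w $ i - ((- s) *s ((*v) N ^^ 1) w) $ i
        = trace N * (N *v (N *v w)) $ i - (det N - s) * (N *v w) $ i" for i
      by (simp add: left_diff_distrib)
    then show ?thesis using True s(2) by (simp add: res3_eq_iff)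
  qed
  then show ?thesis using s by (intro that[of "- s" 1]) auto
next
  case False
  obtain s where s: "s \<in> {1, -1}" "3 dvd trace N - s" using unit_mod_3[OF False] .
  have d1: "3 dvd det N - 1" using d no False by presburger
  have s2: "s * s = 1" using s by auto
  have "res3 (((*v) N ^^ 3) w) = res3 ((- s) *s ((*v) N ^^ 0) w)" for w
  proof -
    let ?t = "trace N" and ?d = "det N"
    have "((*v) N ^^ 3) w = ?t *s (N *v (N *v w)) - ?d *s (N *v w)"
      using cayley_hamilton_2[of N "N *v w"] by (simp add: numeral_3_eq_3)
    also have "N *v (N *v w) = ?t *s (N *v w) - ?d *s w" by (rule cayley_hamilton_2)
    finally have "((*v) N ^^ 3) w $ i = ?t * (?t * (N *v w) $ i - ?d * w $ i) - ?d * (N *v w) $ i" for i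
      by (simp only: vector_minus_component vector_smult_component)
    then have "((*v) N ^^ 3) w $ i - ((- s) *s ((*v) N ^^ 0) w) $ i
        = (?t * ?t - ?d) * (N *v w) $ i + (s - ?t * ?d) * w $ i" for i
      by (simp add: left_diff_distrib right_diff_distrib)
    moreover have "3 dvd ?t * ?t - ?d"
    proof -
      have eq: "?t * ?t - ?d = (?t - s) * (?t + s) - (?d - 1)" using s2 by (simp add: algebra_simps)
      show ?thesis unfolding eq by (intro dvd_diff dvd_mult2 s(2) d1)
    qed
    moreover have "3 dvd s - ?t * ?d"
    proof -
      have "s - ?t * ?d = - (?t - s) - ?t * (?d - 1)" by (simp add: algebra_simps)
      then show ?thesis using s(2) d1 by (metis dvd_diff dvd_minus_iff dvd_mult)
    qed
    ultimately show ?thesis by (simp add: res3_eq_iff)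
  qed
  then show ?thesis using s by (intro that[of "- s" 0]) auto
qed

lemma orbit_mod_3_short:
  fixes N :: "int^2^2"
  assumes "\<not> 3 dvd det N" and "\<not> (\<not> 3 dvd trace N \<and> 3 dvd det N + 1)"
  shows "\<exists>s\<in>{1, -1}. \<exists>j<3. res3 (((*v) N ^^ n) w) = res3 (s *s ((*v) N ^^ j) w)"
proof (induction n)
  case 0
  show ?case by (intro bexI[of _ 1] exI[of _ 0]) auto
next
  case (Suc n)
  obtain r i where ri: "r \<in> {1, -1}" "i < 3"
    "\<And>w. res3 (((*v) N ^^ 3) w) = res3 (r *s ((*v) N ^^ i) w)"
    using cube_returns_mod_3[OF assms] by metis
  obtain s j where sj: "s \<in> {1, -1}" "j < 3"
    "res3 (((*v) N ^^ n) w) = res3 (s *s ((*v) N ^^ j) w)"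
    using Suc by blast
  have "res3 (((*v) N ^^ Suc n) w) = res3 (N *v (s *s ((*v) N ^^ j) w))"
    using res3_mult_cong[OF sj(3)] by simp
  also have "N *v (s *s ((*v) N ^^ j) w) = s *s ((*v) N ^^ Suc j) w"
    by (simp add: vec_eq_iff forall_2 matrix_vector_mult_def sum_2 algebra_simps)
  finally have step: "res3 (((*v) N ^^ Suc n) w) = res3 (s *s ((*v) N ^^ Suc j) w)" .
  show ?case
  proof (cases "Suc j < 3")
    case True
    then show ?thesis using step sj(1) by blast
  next
    case False
    then have "Suc j = 3" using sj(2) by simp
    then have "res3 (((*v) N ^^ Suc n) w) = res3 (s *s (r *s ((*v) N ^^ i) w))"
      using step res3_smult_cong[OF ri(3)] by simp
    then have "res3 (((*v) N ^^ Suc n) w) = res3 ((s * r) *s ((*v) N ^^ i) w)"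
      by (simp add: vector_smult_assoc)
    moreover have "s * r \<in> {1, -1}" using sj(1) ri(1) by auto
    ultimately show ?thesis using ri(2) by blast
  qed
qed

text \<open>\<open>-1\<close> is not a square modulo 3.\<close>

lemma sum_squares_mod_3:
  assumes "3 dvd x * x + y * (y::int)"
  shows "3 dvd y"
proof (rule ccontr)
  assume "\<not> 3 dvd y"
  then obtain s where s: "s \<in> {1, -1}" "3 dvd y - s" using unit_mod_3 by blast
  have "x * x + y * y = x * x + 1 + (y - s) * (y + s)" using s(1) by (auto simp: algebra_simps)
  with assms s(2) have x: "3 dvd x * x + 1" by (metis dvd_add_left_iff dvd_mult2)
  show False
  proof (cases "3 dvd x")
    case True
    with x show False by (metis dvd_add_right_iff dvd_mult2 zdvd1_eq abs_numeral one_eq_numeral_iff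
          semiring_norm(84))
  next
    case False
    then obtain r where r: "r \<in> {1, -1}" "3 dvd x - r" using unit_mod_3 by blast
    have "x * x + 1 = 2 + (x - r) * (x + r)" using r(1) by (auto simp: algebra_simps)
    with x r(2) have "3 dvd (2::int)" by (metis dvd_add_left_iff dvd_mult2)
    then show False by simp
  qed
qed

text \<open>The determinant of \<open>w\<close> and \<open>N w\<close> is a quadratic form in \<open>w\<close> whose discriminant is that of the
  characteristic polynomial, \<open>t\<^sup>2 - 4 d \<equiv> 1 + 4 \<equiv> -1\<close>. Completing the square in either variable turns a
  zero of the form into a zero of \<open>X\<^sup>2 + Y\<^sup>2\<close> modulo 3.\<close>

lemma no_eigenvector_mod_3:
  fixes N :: "int^2^2"
  assumes t: "\<not> 3 dvd trace N" and d: "3 dvd det N + 1" and w: "res3 w \<noteq> res3 0"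
  shows "\<not> 3 dvd w $ 1 * (N *v w) $ 2 - w $ 2 * (N *v w) $ 1" (is "\<not> 3 dvd ?q")
proof
  assume q: "3 dvd ?q"
  let ?a = "N $ 1 $ 1" and ?b = "N $ 1 $ 2" and ?c = "N $ 2 $ 1" and ?e = "N $ 2 $ 2"
  let ?x = "w $ 1" and ?y = "w $ 2"
  obtain s where s: "s \<in> {1, -1}" "3 dvd trace N - s" using unit_mod_3[OF t] .
  define \<Delta> where "\<Delta> = (trace N)\<^sup>2 - 4 * det N"
  have "\<Delta> = (trace N - s) * (trace N + s) - 4 * (det N + 1) + 5"
    using s(1) by (auto simp: \<Delta>_def power2_eq_square algebra_simps)
  moreover have "(trace N - s) * (trace N + s) - 4 * (det N + 1) + 5 + 1
      = (trace N - s) * (trace N + s) - 4 * (det N + 1) + 3 * 2" by simp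
  ultimately have \<Delta>: "3 dvd \<Delta> + 1" using s(2) d by (metis dvd_add dvd_diff dvd_mult dvd_mult2 dvd_triv_left)
  have \<Delta>': "\<Delta> = (?e - ?a)\<^sup>2 + 4 * ?b * ?c"
    by (simp add: \<Delta>_def trace_2 det_2 power2_eq_square algebra_simps)
  have q': "?q = ?c * ?x * ?x + (?e - ?a) * ?x * ?y - ?b * ?y * ?y"
    by (simp add: matrix_vector_mult_def sum_2 algebra_simps)
  let ?X = "2 * ?c * ?x + (?e - ?a) * ?y" and ?Y = "2 * ?b * ?y - (?e - ?a) * ?x"
  have "?X * ?X + ?y * ?y = 4 * ?c * ?q + (\<Delta> + 1) * (?y * ?y)"
    unfolding q' \<Delta>' by (simp add: power2_eq_square algebra_simps)
  then have "3 dvd ?X * ?X + ?y * ?y" using q \<Delta> by (metis dvd_add dvd_mult dvd_mult2)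
  then have y: "3 dvd ?y" by (rule sum_squares_mod_3)
  have "?Y * ?Y + ?x * ?x = - 4 * ?b * ?q + (\<Delta> + 1) * (?x * ?x)"
    unfolding q' \<Delta>' by (simp add: power2_eq_square algebra_simps)
  then have "3 dvd ?Y * ?Y + ?x * ?x" using q \<Delta> by (metis dvd_add dvd_mult dvd_mult2)
  then have "3 dvd ?x" by (rule sum_squares_mod_3)
  with y w show False by (simp add: res3_eq_iff)
qed

text \<open>Here \<open>w\<close> and \<open>z = N w\<close> are a basis modulo 3, and with \<open>\<tau> = \<plusminus>1\<close> the trace modulo 3,
  \<open>N\<^sup>2 w \<equiv> w + \<tau> z\<close> and \<open>N\<^sup>3 w \<equiv> \<tau> w - z\<close>. So \<open>w, N w, N\<^sup>2 w, N\<^sup>3 w\<close> span the four lines with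
  coordinate ratios \<open>(1 : 0), (0 : 1), (1 : \<tau>), (1 : -\<tau>)\<close>, one of which contains \<open>V\<close>.\<close>

lemma orbit_mod_3_full:
  fixes N :: "int^2^2"
  assumes t: "\<not> 3 dvd trace N" and d: "3 dvd det N + 1"
    and w: "res3 w \<noteq> res3 0" and V: "res3 V \<noteq> res3 0"
  shows "\<exists>k<4. \<exists>s\<in>{1, -1}. res3 (((*v) N ^^ k) w) = res3 (s *s V)"
proof -
  define z where "z = N *v w"
  define \<delta> where "\<delta> = w $ 1 * z $ 2 - w $ 2 * z $ 1"
  define x where "x = V $ 1 * z $ 2 - V $ 2 * z $ 1"
  define y where "y = w $ 1 * V $ 2 - w $ 2 * V $ 1"
  have \<delta>: "\<not> 3 dvd \<delta>" unfolding \<delta>_def z_def by (rule no_eigenvector_mod_3[OF t d w])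
  obtain \<epsilon> where \<epsilon>: "\<epsilon> \<in> {1, -1}" "3 dvd \<delta> - \<epsilon>" using unit_mod_3[OF \<delta>] .
  obtain \<tau> where \<tau>: "\<tau> \<in> {1, -1}" "3 dvd trace N - \<tau>" using unit_mod_3[OF t] .
  have residue: "\<exists>\<sigma>\<in>{0, 1, -1}. 3 dvd u - \<sigma>" for u :: int by (simp, presburger)
  obtain \<sigma> where \<sigma>: "\<sigma> \<in> {0, 1, -1}" "3 dvd x - \<sigma>" using residue by blast
  obtain \<rho> where \<rho>: "\<rho> \<in> {0, 1, -1}" "3 dvd y - \<rho>" using residue by blast
  have cramer: "\<delta> * V $ i = x * w $ i + y * z $ i" for i
    using exhaust_2[of i] by (auto simp: \<delta>_def x_def y_def algebra_simps)
  have comb: "3 dvd \<epsilon> * V $ i - (\<sigma> * w $ i + \<rho> * z $ i)" for i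
  proof -
    have "\<epsilon> * V $ i - (\<sigma> * w $ i + \<rho> * z $ i)
        = (x - \<sigma>) * w $ i + (y - \<rho>) * z $ i - (\<delta> - \<epsilon>) * V $ i"
      using cramer[of i] by (simp add: algebra_simps)
    then show ?thesis using \<epsilon>(2) \<sigma>(2) \<rho>(2) by simp
  qed
  have N2: "((*v) N ^^ 2) w = trace N *s z - det N *s w"
    using cayley_hamilton_2[of N w] by (simp add: z_def numeral_2_eq_2)
  have N3: "((*v) N ^^ 3) w = trace N *s ((*v) N ^^ 2) w - det N *s z"
    using cayley_hamilton_2[of N "N *v w"] by (simp add: z_def numeral_2_eq_2 numeral_3_eq_3)
  have n2: "3 dvd ((*v) N ^^ 2) w $ i - (\<tau> * z $ i + w $ i)" for i
  proof -
    have "((*v) N ^^ 2) w $ i - (\<tau> * z $ i + w $ i)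
        = (trace N - \<tau>) * z $ i - (det N + 1) * w $ i"
      by (simp add: N2 algebra_simps)
    then show ?thesis using \<tau>(2) d by simp
  qed
  have n3: "3 dvd ((*v) N ^^ 3) w $ i - (\<tau> * ((*v) N ^^ 2) w $ i + z $ i)" for i
  proof -
    have "((*v) N ^^ 3) w $ i - (\<tau> * ((*v) N ^^ 2) w $ i + z $ i)
        = (trace N - \<tau>) * ((*v) N ^^ 2) w $ i - (det N + 1) * z $ i"
      by (simp add: N3 algebra_simps)
    then show ?thesis using \<tau>(2) d by simp
  qed
  have nonzero: "\<not> (\<sigma> = 0 \<and> \<rho> = 0)"
  proof
    assume "\<sigma> = 0 \<and> \<rho> = 0"
    then have "3 dvd V $ i" for i using comb[of i] \<epsilon>(1) by auto
    with V show False by (simp add: res3_eq_iff)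
  qed
  have goal: ?thesis if "k < 4" "s \<in> {1, -1}" "\<And>i. 3 dvd ((*v) N ^^ k) w $ i - s * V $ i" for k s
    using that by (intro exI[of _ k] conjI bexI[of _ s]) (auto simp: res3_eq_iff)
  have sq: "\<tau> * \<tau> = 1" using \<tau>(1) by auto
  consider "\<rho> = 0" | "\<sigma> = 0" | "\<rho> = \<tau> * \<sigma>" "\<sigma> \<in> {1, -1}" | "\<rho> = - \<tau> * \<sigma>" "\<sigma> \<in> {1, -1}"
    using \<rho>(1) \<sigma>(1) \<tau>(1) by auto
  then show ?thesis
  proof cases
    case 1
    then have \<sigma>1: "\<sigma> \<in> {1, -1}" using \<sigma>(1) nonzero by auto
    have "w $ i - \<epsilon> * \<sigma> * V $ i = - \<sigma> * (\<epsilon> * V $ i - (\<sigma> * w $ i + \<rho> * z $ i))" for i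
      using 1 \<sigma>1 by auto
    then have "3 dvd ((*v) N ^^ 0) w $ i - \<epsilon> * \<sigma> * V $ i" for i
      using comb[of i] by (simp only: funpow_0 dvd_mult)
    then show ?thesis using \<epsilon>(1) \<sigma>1 by (intro goal[of 0 "\<epsilon> * \<sigma>"]) auto
  next
    case 2
    then have \<rho>1: "\<rho> \<in> {1, -1}" using \<rho>(1) nonzero by auto
    have "z $ i - \<epsilon> * \<rho> * V $ i = - \<rho> * (\<epsilon> * V $ i - (\<sigma> * w $ i + \<rho> * z $ i))" for i
      using 2 \<rho>1 by auto
    then have "3 dvd z $ i - \<epsilon> * \<rho> * V $ i" for i
      using comb[of i] by (simp only: dvd_mult)
    then show ?thesis using \<epsilon>(1) \<rho>1 by (intro goal[of 1 "\<epsilon> * \<rho>"]) (auto simp: z_def)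
  next
    case 3
    then have \<sigma>2: "\<sigma> * \<sigma> = 1" by auto
    have "((*v) N ^^ 2) w $ i - \<epsilon> * \<sigma> * V $ i = (((*v) N ^^ 2) w $ i - (\<tau> * z $ i + w $ i))
        - \<sigma> * (\<epsilon> * V $ i - (\<sigma> * w $ i + \<rho> * z $ i))
        + (1 - \<sigma> * \<sigma>) * (w $ i + \<tau> * z $ i)" for i
      unfolding 3(1) by (simp add: algebra_simps)
    then have "3 dvd ((*v) N ^^ 2) w $ i - \<epsilon> * \<sigma> * V $ i" for i
      using comb[of i] n2[of i] \<sigma>2 by (simp only: dvd_mult dvd_diff dvd_add diff_self mult_zero_left dvd_0_right)
    then show ?thesis using 3(2) \<epsilon>(1) by (intro goal[of 2 "\<epsilon> * \<sigma>"]) auto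
  next
    case 4
    then have \<sigma>2: "\<sigma> * \<sigma> = 1" by auto
    have "((*v) N ^^ 3) w $ i - \<epsilon> * \<sigma> * \<tau> * V $ i
        = (((*v) N ^^ 3) w $ i - (\<tau> * ((*v) N ^^ 2) w $ i + z $ i))
        + \<tau> * (((*v) N ^^ 2) w $ i - (\<tau> * z $ i + w $ i)) + 3 * z $ i
        - \<sigma> * \<tau> * (\<epsilon> * V $ i - (\<sigma> * w $ i + \<rho> * z $ i))
        + (1 - \<sigma> * \<sigma>) * (\<tau> * w $ i) + (\<sigma> * \<sigma> * (\<tau> * \<tau>) + \<tau> * \<tau> - 2) * z $ i" for i
      unfolding 4(1) by (simp add: algebra_simps)
    moreover have "\<sigma> * \<sigma> * (\<tau> * \<tau>) + \<tau> * \<tau> - 2 = 0" by (simp add: sq \<sigma>2)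
    ultimately have "3 dvd ((*v) N ^^ 3) w $ i - \<epsilon> * \<sigma> * \<tau> * V $ i" for i
      using comb[of i] n2[of i] n3[of i] \<sigma>2
      by (simp only: dvd_mult dvd_diff dvd_add diff_self mult_zero_left dvd_0_right dvd_triv_left)
    then show ?thesis using 4(2) \<epsilon>(1) \<tau>(1) by (intro goal[of 3 "\<epsilon> * \<sigma> * \<tau>"]) auto
  qed
qed

section \<open>Orthogonal exponentials for three digits\<close>

definition real_vec :: "int^2 \<Rightarrow> real^2" where
  "real_vec w = (\<chi> i. real_of_int (w $ i))"

lemma real_vec_nth [simp]: "real_vec w $ i = real_of_int (w $ i)"
  by (simp add: real_vec_def)

lemma inj_real_vec: "inj real_vec"
  by (auto simp: inj_def vec_eq_iff)

lemma real_vec_diff: "real_vec (v - w) = real_vec v - real_vec w"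
  by (simp add: vec_eq_iff)

lemma inner_2: "(x :: real^2) \<bullet> y = x $ 1 * y $ 1 + x $ 2 * y $ 2"
  by (simp add: inner_vec_def sum_2)

lemma trace_transpose: "trace (transpose M) = trace M"
  by (simp add: trace_def transpose_def)

lemma real_vec_mult:
  "real_vec (transpose M *v w) = transpose (map_matrix real_of_int M) *v real_vec w"
  by (simp add: vec_eq_iff matrix_vector_mult_def sum_2 transpose_def)

lemma is_self_affine_measure_iff:
  "is_self_affine_measure M D \<mu> \<longleftrightarrow> invariant_law ((*v) (matrix_inv M)) D \<mu>"
proof -
  have "ifs_map M d = (\<lambda>x. matrix_inv M *v (x + d))" for d
    by (simp add: fun_eq_iff ifs_map_def)
  then show ?thesis by (simp add: is_self_affine_measure_def invariant_law_def)
qed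

lemma expo_eq_circle_exp: "expo l x = circle_exp (l \<bullet> x)"
  by (simp add: expo_def circle_exp_def cis_conv_exp mult_ac)

lemma L2_inner_expo: "L2_inner \<mu> (expo l) (expo l') = (\<integral>x. circle_exp ((l - l') \<bullet> x) \<partial>\<mu>)"
proof -
  have "circle_exp (l \<bullet> x) * cnj (circle_exp (l' \<bullet> x)) = circle_exp ((l - l') \<bullet> x)" for x
    using circle_exp_add[of "l \<bullet> x" "- (l' \<bullet> x)"]
    by (simp add: inner_diff_left circle_exp_minus)
  then show ?thesis by (simp add: L2_inner_def expo_eq_circle_exp)
qed

text \<open>In this locale \<open>b\<close> is the determinant of the matrix with columns \<open>\<alpha>, \<beta>\<close>. The vector \<open>V\<close> is orthogonal
  to \<open>\<alpha> + \<beta>\<close> and has inner product \<open>b\<close> with \<open>\<alpha>\<close>; modulo 3 it therefore spans the vectors whose inner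
  products with \<open>\<alpha>\<close> and \<open>\<beta>\<close> are opposite.\<close>

locale three_digit_ifs =
  fixes M :: "int^2^2" and \<alpha>1 \<alpha>2 \<beta>1 \<beta>2 :: int
  assumes adm: "admissible M \<alpha>1 \<alpha>2 \<beta>1 \<beta>2"
begin

abbreviation "A \<equiv> matrix_inv (map_matrix real_of_int M)"
abbreviation "N \<equiv> transpose M"
definition "\<alpha> = real_vec (vector [\<alpha>1, \<alpha>2])"
definition "\<beta> = real_vec (vector [\<beta>1, \<beta>2])"
definition "b = \<alpha>1 * \<beta>2 - \<alpha>2 * \<beta>1"
definition V :: "int^2" where "V = vector [\<alpha>2 + \<beta>2, - (\<alpha>1 + \<beta>1)]"

lemma expanding_M: "expanding (map_matrix real_of_int M)"
  and b: "\<not> 3 dvd b" and det_M: "\<not> 3 dvd det M"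
  using adm by (auto simp: admissible_def b_def)

lemma digit_set_eq: "digit_set \<alpha>1 \<alpha>2 \<beta>1 \<beta>2 = {0, \<alpha>, \<beta>}"
proof -
  have "vector [0, 0] = (0 :: real^2)" "vector [real_of_int \<alpha>1, real_of_int \<alpha>2] = \<alpha>"
    "vector [real_of_int \<beta>1, real_of_int \<beta>2] = \<beta>"
    by (simp_all add: \<alpha>_def \<beta>_def vec_eq_iff forall_2)
  then show ?thesis by (simp add: digit_set_def)
qed

lemma digits_distinct: "\<alpha> \<noteq> 0" "\<beta> \<noteq> 0" "\<alpha> \<noteq> \<beta>"
  using b by (auto simp: \<alpha>_def \<beta>_def b_def vec_eq_iff forall_2)

sublocale contracting_ifs "(*v) A" "{0, \<alpha>, \<beta>}"
  by (rule contracting_ifs.intro)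
    (auto intro: expanding_summable_inverse_orbit[OF expanding_M] matrix_vector_mul_bounded_linear)

lemma invariant_law_\<mu>_MD: "invariant_law ((*v) A) {0, \<alpha>, \<beta>} (\<mu>_MD M \<alpha>1 \<alpha>2 \<beta>1 \<beta>2)"
proof -
  have "\<mu>_MD M \<alpha>1 \<alpha>2 \<beta>1 \<beta>2 = (THE \<mu>. invariant_law ((*v) A) {0, \<alpha>, \<beta>} \<mu>)"
    by (simp add: \<mu>_MD_def self_affine_measure_def is_self_affine_measure_iff digit_set_eq)
  moreover have "\<exists>!\<mu>. invariant_law ((*v) A) {0, \<alpha>, \<beta>} \<mu>"
    using invariant_law_exists invariant_law_unique by blast
  ultimately show ?thesis using theI'[of "invariant_law ((*v) A) {0, \<alpha>, \<beta>}"] by simp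
qed

lemma prob_space_\<mu>_MD: "prob_space (\<mu>_MD M \<alpha>1 \<alpha>2 \<beta>1 \<beta>2)"
  using invariant_law_\<mu>_MD by (simp add: invariant_law_def)

text \<open>The zero set of the Fourier transform of the measure, in the arithmetic form provided by
  \<open>cube_root_sum_eq_0_iff\<close>.\<close>

definition vanishing :: "real^2 \<Rightarrow> bool" where
  "vanishing \<xi> \<longleftrightarrow> (\<exists>n. \<exists>p q :: int.
     3 * (\<xi> \<bullet> ((*v) A ^^ Suc n) \<alpha>) = of_int p \<and> 3 * (\<xi> \<bullet> ((*v) A ^^ Suc n) \<beta>) = of_int q \<and>
     \<not> 3 dvd p \<and> 3 dvd p + q)"

lemma L2_inner_eq_0_iff:
  "L2_inner (\<mu>_MD M \<alpha>1 \<alpha>2 \<beta>1 \<beta>2) (expo l) (expo l') = 0 \<longleftrightarrow> vanishing (l - l')"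
proof -
  have "(\<Sum>d\<in>{0, \<alpha>, \<beta>}. circle_exp (\<xi> \<bullet> ((*v) A ^^ Suc n) d))
      = 1 + circle_exp (\<xi> \<bullet> ((*v) A ^^ Suc n) \<alpha>) + circle_exp (\<xi> \<bullet> ((*v) A ^^ Suc n) \<beta>)" for \<xi> n
  proof -
    have "((*v) A ^^ Suc n) 0 = 0"
      by (rule linear_0[OF bounded_linear.linear[OF bounded_linear_funpow]])
    then show ?thesis using digits_distinct by (simp add: add.assoc del: funpow.simps)
  qed
  then show ?thesis
    unfolding L2_inner_expo fourier_eq_0_iff[OF invariant_law_\<mu>_MD]
    by (simp only: cube_root_sum_eq_0_iff vanishing_def)
qed

lemma inner_funpow: "\<xi> \<bullet> ((*v) A ^^ n) v = ((*v) (transpose A) ^^ n) \<xi> \<bullet> v"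
proof (induction n arbitrary: \<xi>)
  case (Suc n)
  have "\<xi> \<bullet> (A *v ((*v) A ^^ n) v) = (transpose A *v \<xi>) \<bullet> ((*v) A ^^ n) v"
    by (simp add: dot_lmul_matrix[symmetric])
  also have "\<dots> = ((*v) (transpose A) ^^ n) (transpose A *v \<xi>) \<bullet> v" by (rule Suc)
  finally show ?case by (simp add: funpow_swap1 del: transpose_matrix_vector)
qed simp

lemma transpose_cancel:
  "transpose (map_matrix real_of_int M) *v (transpose A *v x) = x"
  "transpose A *v (transpose (map_matrix real_of_int M) *v x) = x"
proof -
  have "(transpose (map_matrix real_of_int M) *v (transpose A *v x)) \<bullet> y = x \<bullet> y"
       "(transpose A *v (transpose (map_matrix real_of_int M) *v x)) \<bullet> y = x \<bullet> y" for y
    by (simp_all add: dot_lmul_matrix matrix_inv_cancel[OF expanding_M])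
  then show "transpose (map_matrix real_of_int M) *v (transpose A *v x) = x"
    "transpose A *v (transpose (map_matrix real_of_int M) *v x) = x"
    using vector_eq_rdot by blast+
qed

lemma funpow_transpose_cancel:
  "((*v) (transpose A) ^^ n) (real_vec (((*v) N ^^ n) w)) = real_vec w"
proof (induction n)
  case (Suc n)
  have "((*v) (transpose A) ^^ Suc n) x = ((*v) (transpose A) ^^ n) (transpose A *v x)" for x
    by (simp only: funpow_Suc_right o_apply)
  then have "((*v) (transpose A) ^^ Suc n) (real_vec (((*v) N ^^ Suc n) w))
      = ((*v) (transpose A) ^^ n) (transpose A *v real_vec (((*v) N ^^ Suc n) w))" .
  also have "((*v) N ^^ Suc n) w = N *v ((*v) N ^^ n) w" by simp
  also have "transpose A *v real_vec (N *v ((*v) N ^^ n) w) = real_vec (((*v) N ^^ n) w)"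
    by (simp only: real_vec_mult transpose_cancel)
  finally show ?case using Suc by (simp only: funpow.simps o_apply)
qed simp

lemma funpow_transpose_eqD:
  assumes "((*v) (transpose A) ^^ n) \<xi> = real_vec w"
  shows "\<xi> = real_vec (((*v) N ^^ n) w)"
  using assms
proof (induction n arbitrary: w)
  case (Suc n)
  from Suc.prems have "transpose A *v ((*v) (transpose A) ^^ n) \<xi> = real_vec w"
    by (simp del: transpose_matrix_vector)
  then have "((*v) (transpose A) ^^ n) \<xi> = real_vec (N *v w)"
    by (metis real_vec_mult transpose_cancel(1))
  from Suc.IH[OF this] show ?case by (simp add: funpow_swap1 del: transpose_matrix_vector)
qed simp

text \<open>The vector \<open>\<zeta> = (A\<^sup>T)\<^sup>n \<xi>\<close> has inner products \<open>p/3\<close> and \<open>q/3\<close> with the digits, so by Cramer's rule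
  \<open>3 b \<zeta>\<close> is an integer vector, congruent to \<open>p V\<close> since \<open>q \<equiv> -p\<close>; applying \<open>N\<^sup>n\<close> recovers \<open>\<xi>\<close>. The
  factor \<open>3 b\<close> is independent of \<open>n\<close>, so that different zeros can be compared.\<close>

lemma vanishing_residue:
  assumes "vanishing \<xi>"
  shows "\<exists>W n. \<exists>s\<in>{1, -1}. (3 * real_of_int b) *\<^sub>R \<xi> = real_vec W
    \<and> res3 W = res3 (s *s ((*v) N ^^ n) V)"
proof -
  from assms obtain n and p q :: int where pq:
    "3 * (\<xi> \<bullet> ((*v) A ^^ Suc n) \<alpha>) = of_int p" "3 * (\<xi> \<bullet> ((*v) A ^^ Suc n) \<beta>) = of_int q"
    "\<not> 3 dvd p" "3 dvd p + q"
    unfolding vanishing_def by blast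
  define \<zeta> where "\<zeta> = ((*v) (transpose A) ^^ Suc n) \<xi>"
  have e1: "3 * (\<zeta> $ 1 * of_int \<alpha>1 + \<zeta> $ 2 * of_int \<alpha>2) = of_int p"
   and e2: "3 * (\<zeta> $ 1 * of_int \<beta>1 + \<zeta> $ 2 * of_int \<beta>2) = of_int q"
    using pq(1,2) unfolding inner_funpow \<zeta>_def[symmetric]
    by (simp_all add: inner_2 \<alpha>_def \<beta>_def)
  define W where "W = (vector [p * \<beta>2 - q * \<alpha>2, q * \<alpha>1 - p * \<beta>1] :: int^2)"
  have "(3 * real_of_int b) * \<zeta> $ 1 = of_int p * of_int \<beta>2 - of_int q * of_int \<alpha>2"
       "(3 * real_of_int b) * \<zeta> $ 2 = of_int q * of_int \<alpha>1 - of_int p * of_int \<beta>1"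
    unfolding e1[symmetric] e2[symmetric] by (simp_all add: b_def algebra_simps)
  then have "(3 * real_of_int b) *\<^sub>R \<zeta> = real_vec W"
    by (simp add: vec_eq_iff forall_2 W_def)
  moreover have "((*v) (transpose A) ^^ Suc n) ((3 * real_of_int b) *\<^sub>R \<xi>) = (3 * real_of_int b) *\<^sub>R \<zeta>"
  proof -
    have "((*v) B ^^ k) (c *\<^sub>R x) = c *\<^sub>R ((*v) B ^^ k) x" for B :: "real^2^2" and c x k
      by (induction k) (simp_all add: matrix_vector_mult_scaleR)
    then show ?thesis by (simp only: \<zeta>_def)
  qed
  ultimately have 1: "(3 * real_of_int b) *\<^sub>R \<xi> = real_vec (((*v) N ^^ Suc n) W)"
    by (intro funpow_transpose_eqD) simp
  obtain s where s: "s \<in> {1, -1}" "3 dvd p - s" using unit_mod_3[OF pq(3)] .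
  have "W $ 1 - s * V $ 1 = (p - s) * V $ 1 - (p + q) * \<alpha>2"
       "W $ 2 - s * V $ 2 = (p - s) * V $ 2 + (p + q) * \<alpha>1"
    by (simp_all add: W_def V_def algebra_simps)
  then have "res3 W = res3 (s *s V)" using s(2) pq(4) by (simp add: res3_eq_iff)
  then have "res3 (((*v) N ^^ Suc n) W) = res3 (((*v) N ^^ Suc n) (s *s V))"
    by (rule res3_funpow_cong)
  also have "((*v) N ^^ k) (s *s V) = s *s ((*v) N ^^ k) V" for k
    by (induction k) (simp_all add: vec_eq_iff forall_2 matrix_vector_mult_def sum_2 algebra_simps)
  finally show ?thesis using 1 s(1) by blast
qed

lemma V_nonzero: "res3 V \<noteq> res3 0"
proof
  assume "res3 V = res3 0"
  then have "3 dvd V $ 1" "3 dvd V $ 2" by (simp_all add: res3_eq_iff)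
  moreover have "b = \<alpha>1 * V $ 1 + \<alpha>2 * V $ 2" by (simp add: b_def V_def algebra_simps)
  ultimately show False using b by simp
qed

lemma orbit_nonzero:
  assumes "s \<in> {1, -1}"
  shows "res3 (s *s ((*v) N ^^ n) V) \<noteq> res3 0"
proof -
  have "res3 (((*v) N ^^ n) V) \<noteq> res3 0"
    using res3_funpow_eq_0[of N n V] V_nonzero det_M by auto
  then show ?thesis using assms by (auto simp: res3_eq_iff)
qed

text \<open>Fix one frequency of the family. The residues of the scaled differences to it determine the members,
  since the difference of two of them is again a scaled zero and so nonzero modulo 3. A set \<open>R\<close>
  of admitted residues serves both bounds: all 9 residues, or the few of a short orbit.\<close>

lemma orthogonal_expos_card_le:
  assumes S: "orthogonal_expos (\<mu>_MD M \<alpha>1 \<alpha>2 \<beta>1 \<beta>2) S"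
    and R: "finite R" "res3 0 \<in> R" "\<And>n s. s \<in> {1, -1} \<Longrightarrow> res3 (s *s ((*v) N ^^ n) V) \<in> R"
  shows "finite S \<and> card S \<le> card R"
proof (cases "S = {}")
  case False
  then obtain g where g: "g \<in> S" by blast
  have "\<forall>h\<in>S. \<exists>l. h = expo l" using S by (auto simp: orthogonal_expos_def)
  then obtain l where l: "\<And>h. h \<in> S \<Longrightarrow> h = expo (l h)" by metis
  have diff: "\<exists>W n. \<exists>s\<in>{1, -1}. (3 * real_of_int b) *\<^sub>R (l h - l k) = real_vec W
      \<and> res3 W = res3 (s *s ((*v) N ^^ n) V)" if "h \<in> S" "k \<in> S" "h \<noteq> k" for h k
  proof (rule vanishing_residue)
    have "L2_inner (\<mu>_MD M \<alpha>1 \<alpha>2 \<beta>1 \<beta>2) h k = 0" using S that by (auto simp: orthogonal_expos_def)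
    then show "vanishing (l h - l k)" using l that(1,2) by (metis L2_inner_eq_0_iff)
  qed
  have "\<exists>W. (3 * real_of_int b) *\<^sub>R (l h - l g) = real_vec W \<and> res3 W \<in> R" if "h \<in> S" for h
  proof (cases "h = g")
    case True
    have "real_vec 0 = 0" by (simp add: vec_eq_iff)
    with True R(2) show ?thesis by (intro exI[of _ 0]) simp
  next
    case False
    with diff[OF that g] R(3) show ?thesis by metis
  qed
  then obtain W where W: "\<And>h. h \<in> S \<Longrightarrow> (3 * real_of_int b) *\<^sub>R (l h - l g) = real_vec (W h)"
    "\<And>h. h \<in> S \<Longrightarrow> res3 (W h) \<in> R" by metis
  have "inj_on (\<lambda>h. res3 (W h)) S"
  proof (rule inj_onI, rule ccontr)
    fix h k assume hk: "h \<in> S" "k \<in> S" "res3 (W h) = res3 (W k)" "h \<noteq> k"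
    obtain U n s where U: "s \<in> {1, -1}" "(3 * real_of_int b) *\<^sub>R (l h - l k) = real_vec U"
      "res3 U = res3 (s *s ((*v) N ^^ n) V)" using diff[OF hk(1,2,4)] by blast
    have "real_vec U = (3 * real_of_int b) *\<^sub>R (l h - l g) - (3 * real_of_int b) *\<^sub>R (l k - l g)"
      unfolding U(2)[symmetric] by (simp add: algebra_simps)
    also have "\<dots> = real_vec (W h - W k)" by (simp add: W(1) hk(1,2) real_vec_diff)
    finally have "U = W h - W k" using inj_real_vec by (simp add: inj_eq)
    then have "res3 U = res3 0" using hk(3) by (simp add: res3_eq_iff)
    with orbit_nonzero[OF U(1)] U(3) show False by metis
  qed
  moreover have "(\<lambda>h. res3 (W h)) ` S \<subseteq> R" using W(2) by auto
  ultimately show ?thesis using R(1) by (blast intro: inj_on_finite card_inj_on_le)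
qed simp

lemma at_most_9: "at_most_orthogonal_expos (\<mu>_MD M \<alpha>1 \<alpha>2 \<beta>1 \<beta>2) 9"
  unfolding at_most_orthogonal_expos_def
proof (intro allI impI)
  fix S assume "orthogonal_expos (\<mu>_MD M \<alpha>1 \<alpha>2 \<beta>1 \<beta>2) S"
  from orthogonal_expos_card_le[OF this, of "{0..<3} \<times> {0..<3}"] res3_in
  show "finite S \<and> card S \<le> 9" by (simp add: card_cartesian_product)
qed

text \<open>The residues are 0 and \<open>\<plusminus>V, \<plusminus>N V, \<plusminus>N\<^sup>2 V\<close>.\<close>

lemma orthogonal_expos_card_le_7:
  assumes no: "\<not> (\<not> 3 dvd trace M \<and> 3 dvd det M + 1)"
    and S: "orthogonal_expos (\<mu>_MD M \<alpha>1 \<alpha>2 \<beta>1 \<beta>2) S"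
  shows "card S \<le> 7"
proof -
  let ?O = "(\<lambda>(s, j). res3 (s *s ((*v) N ^^ j) V)) ` ({1, -1} \<times> {..<3})"
  have N: "\<not> 3 dvd det N" "\<not> (\<not> 3 dvd trace N \<and> 3 dvd det N + 1)"
    using det_M no by (simp_all add: trace_transpose)
  have "res3 (s *s ((*v) N ^^ n) V) \<in> ?O" if s: "s \<in> {1, -1}" for s n
  proof -
    obtain r j where rj: "r \<in> {1, -1}" "j < 3"
      "res3 (((*v) N ^^ n) V) = res3 (r *s ((*v) N ^^ j) V)"
      using orbit_mod_3_short[OF N, of n V] by blast
    have "res3 (s *s ((*v) N ^^ n) V) = res3 ((s * r) *s ((*v) N ^^ j) V)"
      using res3_smult_cong[OF rj(3), of s] by (simp add: vector_smult_assoc)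
    moreover have "s * r \<in> {1, -1}" using s rj(1) by auto
    ultimately show ?thesis using rj(2) by (intro image_eqI[of _ _ "(s * r, j)"]) auto
  qed
  then have "card S \<le> card (insert (res3 0) ?O)"
    using orthogonal_expos_card_le[OF S, of "insert (res3 0) ?O"] by simp
  also have "\<dots> \<le> Suc (card ?O)" by (rule card_insert_le_m1) simp_all
  also have "card ?O \<le> card ({1, -1 :: int} \<times> {..<3 :: nat})" by (rule card_image_le) simp
  also have "card ({1, -1 :: int} \<times> {..<3 :: nat}) = 6" by (simp add: card_cartesian_product)
  finally show ?thesis by simp
qed

text \<open>For \<open>\<xi> = N\<^sup>4 w / 3\<close> the vector \<open>(A\<^sup>T)\<^sup>n \<xi>\<close> is \<open>N\<^bsup>4-n\<^esup> w / 3\<close> when \<open>1 \<le> n \<le> 4\<close>, so these four values of \<open>n\<close>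
  test \<open>N\<^sup>k w\<close> for \<open>k = 3, 2, 1, 0\<close>, and one of these is congruent to \<open>\<plusminus>V\<close>.\<close>

lemma vanishing_lattice:
  assumes t: "\<not> 3 dvd trace M" and d: "3 dvd det M + 1" and w: "res3 w \<noteq> res3 0"
  shows "vanishing ((1 / 3) *\<^sub>R real_vec (((*v) N ^^ 4) w))"
proof -
  have "\<not> 3 dvd trace N" "3 dvd det N + 1" using t d by (simp_all add: trace_transpose)
  from orbit_mod_3_full[OF this w V_nonzero] obtain k s where
    k: "k < 4" "s \<in> {1, -1}" "res3 (((*v) N ^^ k) w) = res3 (s *s V)" by blast
  \<comment> \<open>The zero occurs at the exponent \<open>4 - k\<close>, which is positive because \<open>k < 4\<close>.\<close>
  define n where "n = 3 - k"
  have n: "Suc n + k = 4" using k(1) by (simp add: n_def)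
  define U where "U = ((*v) N ^^ k) w"
  have U4: "((*v) N ^^ 4) w = ((*v) N ^^ Suc n) U"
    unfolding U_def n[symmetric] funpow_add by simp
  have inner: "3 * (((1 / 3) *\<^sub>R real_vec (((*v) N ^^ 4) w)) \<bullet> ((*v) A ^^ Suc n) v) = real_vec U \<bullet> v" for v
  proof -
    have "3 * (((1 / 3) *\<^sub>R real_vec (((*v) N ^^ 4) w)) \<bullet> ((*v) A ^^ Suc n) v)
        = real_vec (((*v) N ^^ 4) w) \<bullet> ((*v) A ^^ Suc n) v"
      by (simp del: funpow.simps)
    also have "\<dots> = real_vec U \<bullet> v"
      by (simp only: U4 inner_funpow funpow_transpose_cancel)
    finally show ?thesis .
  qed
  define p where "p = U $ 1 * \<alpha>1 + U $ 2 * \<alpha>2"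
  define q where "q = U $ 1 * \<beta>1 + U $ 2 * \<beta>2"
  have U: "3 dvd U $ 1 - s * V $ 1" "3 dvd U $ 2 - s * V $ 2"
    using k(3) by (simp_all add: res3_eq_iff U_def)
  have "p + q = (U $ 1 - s * V $ 1) * (\<alpha>1 + \<beta>1) + (U $ 2 - s * V $ 2) * (\<alpha>2 + \<beta>2)"
    by (simp add: p_def q_def V_def algebra_simps)
  then have "3 dvd p + q" using U by simp
  moreover have "\<not> 3 dvd p"
  proof
    assume "3 dvd p"
    moreover have "s * b = p - ((U $ 1 - s * V $ 1) * \<alpha>1 + (U $ 2 - s * V $ 2) * \<alpha>2)"
      by (simp add: p_def b_def V_def algebra_simps)
    ultimately have "3 dvd s * b" using U by simp
    then show False using b k(2) by auto
  qed
  moreover have "real_vec U \<bullet> \<alpha> = of_int p" "real_vec U \<bullet> \<beta> = of_int q"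
    by (simp_all add: inner_2 \<alpha>_def \<beta>_def p_def q_def)
  ultimately show ?thesis unfolding vanishing_def using inner by metis
qed

lemma attains_9:
  assumes t: "\<not> 3 dvd trace M" and d: "3 dvd det M + 1"
  shows "attains_orthogonal_expos (\<mu>_MD M \<alpha>1 \<alpha>2 \<beta>1 \<beta>2) 9"
proof -
  let ?\<mu> = "\<mu>_MD M \<alpha>1 \<alpha>2 \<beta>1 \<beta>2"
  interpret \<mu>: prob_space ?\<mu> by (rule prob_space_\<mu>_MD)
  define W :: "int \<times> int \<Rightarrow> int^2" where "W z = vector [fst z, snd z]" for z
  define l where "l z = (1 / 3) *\<^sub>R real_vec (((*v) N ^^ 4) (W z))" for z
  let ?I = "{0..<3} \<times> {0..<3} :: (int \<times> int) set"
  have orth: "L2_inner ?\<mu> (expo (l z)) (expo (l z')) = 0" if "z \<in> ?I" "z' \<in> ?I" "z \<noteq> z'" for z z'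
  proof -
    have "res3 (W z - W z') \<noteq> res3 0"
    proof
      assume "res3 (W z - W z') = res3 0"
      then have "fst z mod 3 = fst z' mod 3" "snd z mod 3 = snd z' mod 3"
        by (simp_all add: res3_eq_iff W_def mod_eq_dvd_iff)
      with that show False by (auto simp: prod_eq_iff)
    qed
    from vanishing_lattice[OF t d this]
    have "vanishing ((1 / 3) *\<^sub>R real_vec (((*v) N ^^ 4) (W z - W z')))" .
    also have "((*v) N ^^ k) (x - y) = ((*v) N ^^ k) x - ((*v) N ^^ k) y" for x y k
      by (induction k) (simp_all add: matrix_vector_mult_diff_distrib del: transpose_matrix_vector)
    finally have "vanishing (l z - l z')"
      by (simp add: l_def real_vec_diff scaleR_diff_right)
    then show ?thesis by (simp only: L2_inner_eq_0_iff)
  qed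
  \<comment> \<open>Orthogonality of unit vectors forces the nine exponentials to be distinct functions.\<close>
  have norm1: "L2_inner ?\<mu> (expo x) (expo x) = 1" for x
    by (simp add: L2_inner_expo \<mu>.prob_space)
  have "inj_on (\<lambda>z. expo (l z)) ?I"
    by (rule inj_onI, rule ccontr) (metis norm1 orth zero_neq_one)
  then have "card ((\<lambda>z. expo (l z)) ` ?I) = 9"
    by (simp add: card_image card_cartesian_product)
  moreover have "orthogonal_expos ?\<mu> ((\<lambda>z. expo (l z)) ` ?I)"
    unfolding orthogonal_expos_def using orth by blast
  ultimately show ?thesis
    unfolding attains_orthogonal_expos_def by (intro exI[of _ "(\<lambda>z. expo (l z)) ` ?I"]) simp
qed

lemma attains_9_iff:
  "attains_orthogonal_expos (\<mu>_MD M \<alpha>1 \<alpha>2 \<beta>1 \<beta>2) 9 \<longleftrightarrow> \<not> 3 dvd trace M \<and> 3 dvd det M + 1"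
proof
  assume "attains_orthogonal_expos (\<mu>_MD M \<alpha>1 \<alpha>2 \<beta>1 \<beta>2) 9"
  then obtain S where S: "orthogonal_expos (\<mu>_MD M \<alpha>1 \<alpha>2 \<beta>1 \<beta>2) S" "card S = 9"
    by (auto simp: attains_orthogonal_expos_def)
  show "\<not> 3 dvd trace M \<and> 3 dvd det M + 1"
  proof (rule ccontr)
    assume "\<not> (\<not> 3 dvd trace M \<and> 3 dvd det M + 1)"
    from orthogonal_expos_card_le_7[OF this S(1)] S(2) show False by simp
  qed
qed (use attains_9 in blast)

end

section \<open>Matrix classes modulo 3\<close>

abbreviation mat2 :: "int \<Rightarrow> int \<Rightarrow> int \<Rightarrow> int \<Rightarrow> int^2^2" where
  "mat2 a b c d \<equiv> vector [vector [a, b], vector [c, d]]"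

lemma mat_cong3_2: "mat_cong3 P Q \<longleftrightarrow>
    3 dvd P $ 1 $ 1 - Q $ 1 $ 1 \<and> 3 dvd P $ 1 $ 2 - Q $ 1 $ 2 \<and>
    3 dvd P $ 2 $ 1 - Q $ 2 $ 1 \<and> 3 dvd P $ 2 $ 2 - Q $ 2 $ 2"
  by (simp add: mat_cong3_def forall_2 cong_iff_dvd_diff)

lemma mat_cong3_sym: "mat_cong3 P Q \<Longrightarrow> mat_cong3 Q P"
  by (simp add: mat_cong3_def cong_sym_eq)

lemma mat_cong3_trans: "mat_cong3 P Q \<Longrightarrow> mat_cong3 Q R \<Longrightarrow> mat_cong3 P R"
  unfolding mat_cong3_def by (blast intro: cong_trans)

lemma mat_cong3_mult:
  assumes "mat_cong3 P P'" "mat_cong3 Q Q'"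
  shows "mat_cong3 (P ** Q) (P' ** Q')"
  using assms unfolding mat_cong3_def
  by (simp add: matrix_matrix_mult_def cong_sum cong_mult)

lemma mat_cong3_trace_det:
  assumes "mat_cong3 P Q"
  shows "[trace P = trace Q] (mod 3)" "[det P = det Q] (mod 3)"
  using assms unfolding mat_cong3_def trace_2 det_2
  by (auto intro!: cong_add cong_diff cong_mult)

text \<open>The 12 matrices are those of order 8 in the general linear group over the field with three elements;
  among invertible matrices this order means characteristic polynomial \<open>x\<^sup>2 \<mp> x - 1\<close>.\<close>

lemma frakM2_iff_trace_det:
  "(\<exists>T\<in>frakM2. mat_cong3 P T) \<longleftrightarrow> \<not> 3 dvd trace P \<and> 3 dvd det P + 1"
proof -
  have cong: "3 dvd trace P \<longleftrightarrow> 3 dvd trace Q" "3 dvd det P + 1 \<longleftrightarrow> 3 dvd det Q + 1"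
    if "mat_cong3 P Q" for Q
    using mat_cong3_trace_det[OF that] cong_dvd_iff[of _ _ 3] cong_add[OF _ cong_refl[of 1]]
    by blast+
  show ?thesis
  proof
    assume "\<exists>T\<in>frakM2. mat_cong3 P T"
    then obtain T where T: "T \<in> frakM2" "mat_cong3 P T" by blast
    from T(1) have "\<not> 3 dvd trace T \<and> 3 dvd det T + 1"
      by (auto simp: frakM2_def Let_def trace_2 det_2)
    then show "\<not> 3 dvd trace P \<and> 3 dvd det P + 1" using cong[OF T(2)] by simp
  next
    assume P: "\<not> 3 dvd trace P \<and> 3 dvd det P + 1"
    have residue: "\<exists>r\<in>{0, 1, -1}. 3 dvd u - r" for u :: int by (simp, presburger)
    obtain a where a: "a \<in> {0, 1, -1}" "3 dvd P $ 1 $ 1 - a" using residue by blast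
    obtain b where b: "b \<in> {0, 1, -1}" "3 dvd P $ 1 $ 2 - b" using residue by blast
    obtain c where c: "c \<in> {0, 1, -1}" "3 dvd P $ 2 $ 1 - c" using residue by blast
    obtain d where d: "d \<in> {0, 1, -1}" "3 dvd P $ 2 $ 2 - d" using residue by blast
    have PQ: "mat_cong3 P (mat2 a b c d)" using a b c d by (simp add: mat_cong3_2)
    have Q: "\<not> 3 dvd a + d" "3 dvd a * d - b * c + 1"
      using P cong[OF PQ] by (simp_all add: trace_2 det_2)
    have uminus: "- mat2 a b c d = mat2 (- a) (- b) (- c) (- d)" for a b c d
      by (simp add: vec_eq_iff forall_2)
    have "mat2 a b c d \<in> frakM2"
      unfolding frakM2_def Let_def image_insert image_empty uminus
      using Q a(1) b(1) c(1) d(1) by (elim insertE emptyE; simp)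
    with PQ show "\<exists>T\<in>frakM2. mat_cong3 P T" by blast
  qed
qed

text \<open>Since \<open>A\<close> is invertible modulo 3, its right inverse \<open>B\<close> is also a left inverse, \<open>B A \<equiv> I\<close>, and
  \<open>tr (A M B) = tr (M (B A))\<close>.\<close>

lemma conjugate_trace_det:
  assumes A: "in_GL2_3 A" and AB: "mat_cong3 (A ** B) (mat 1)"
  shows "[trace (A ** M ** B) = trace M] (mod 3)" "[det (A ** M ** B) = det M] (mod 3)"
proof -
  have refl: "mat_cong3 P P" for P by (simp add: mat_cong3_def)
  obtain C where C: "mat_cong3 (C ** A) (mat 1)" using A by (auto simp: in_GL2_3_def)
  have 1: "mat_cong3 (C ** (A ** B)) C" using mat_cong3_mult[OF refl[of C] AB] by simp
  have 2: "mat_cong3 (C ** (A ** B)) B"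
    using mat_cong3_mult[OF C refl[of B]] by (simp add: matrix_mul_assoc)
  have "mat_cong3 B C" by (rule mat_cong3_trans[OF mat_cong3_sym[OF 2] 1])
  from mat_cong3_trans[OF mat_cong3_mult[OF this refl] C]
  have BA: "mat_cong3 (B ** A) (mat 1)" .
  have "trace (A ** M ** B) = trace (M ** (B ** A))"
    by (metis trace_mul_sym matrix_mul_assoc)
  moreover have "mat_cong3 (M ** (B ** A)) (M ** mat 1)" by (rule mat_cong3_mult[OF refl BA])
  ultimately show "[trace (A ** M ** B) = trace M] (mod 3)"
    using mat_cong3_trace_det(1)[of "M ** (B ** A)" M] by simp
  have "det (A ** M ** B) = det M * det (A ** B)" by (simp add: det_mul)
  moreover have "[det (A ** B) = 1] (mod 3)" using mat_cong3_trace_det(2)[OF AB] by simp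
  ultimately show "[det (A ** M ** B) = det M] (mod 3)"
    using cong_mult[OF cong_refl[of "det M"], of "det (A ** B)" 1 3] by simp
qed

text \<open>The eigenvalues are the roots of \<open>z\<^sup>2 - z - 4\<close>; in the closed unit disc \<open>z\<^sup>2 - z\<close> has modulus at most 2.\<close>

lemma admissible_example: "admissible (mat2 0 1 4 1) 1 0 0 1"
proof -
  have "cmod z > 1"
    if v: "v \<noteq> 0" and eig: "map_matrix complex_of_real (map_matrix real_of_int (mat2 0 1 4 1)) *v v = z *s v"
    for z v
  proof (rule ccontr)
    assume "\<not> cmod z > 1"
    have "v $ 2 = z * v $ 1 \<and> 4 * v $ 1 + v $ 2 = z * v $ 2"
      using eig by (auto simp: vec_eq_iff forall_2 matrix_vector_mult_def sum_2)
    then have v2: "v $ 2 = z * v $ 1" and eq: "4 * v $ 1 + v $ 2 = z * v $ 2" by blast+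
    have "(z * z - z - 4) * v $ 1 = 0" using eq unfolding v2 by (simp add: algebra_simps)
    moreover have "v $ 1 \<noteq> 0" using v v2 by (auto simp: vec_eq_iff forall_2)
    ultimately have "z * z - z - 4 = 0" by simp
    then have "4 = z * z - z" by (simp add: algebra_simps)
    then have "4 = cmod (z * z - z)" by (metis norm_numeral)
    also have "\<dots> \<le> cmod z * cmod z + cmod z"
      using norm_triangle_ineq4[of "z * z" z] by (simp add: norm_mult)
    also have "\<dots> \<le> 1 * 1 + 1"
      using \<open>\<not> cmod z > 1\<close> by (intro add_mono mult_mono) auto
    finally show False by simp
  qed
  then show ?thesis by (auto simp: admissible_def expanding_def det_2)
qed

section \<open>The best bound and its attainment\<close>

text \<open>The bound 9 cannot be lowered because \<open>mat2 0 1 4 1\<close> with the standard basis vectors as digits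
  has trace 1 and determinant \<open>-4\<close>, and so attains it.\<close>

theorem corollary1p9:
  shows "(\<forall>M \<alpha>1 \<alpha>2 \<beta>1 \<beta>2. admissible M \<alpha>1 \<alpha>2 \<beta>1 \<beta>2 \<longrightarrow>
            at_most_orthogonal_expos (\<mu>_MD M \<alpha>1 \<alpha>2 \<beta>1 \<beta>2) 9)
       \<and> \<not> (\<exists>n<9. \<forall>M \<alpha>1 \<alpha>2 \<beta>1 \<beta>2. admissible M \<alpha>1 \<alpha>2 \<beta>1 \<beta>2 \<longrightarrow>
            at_most_orthogonal_expos (\<mu>_MD M \<alpha>1 \<alpha>2 \<beta>1 \<beta>2) n)
       \<and> (\<forall>M \<alpha>1 \<alpha>2 \<beta>1 \<beta>2 A. admissible M \<alpha>1 \<alpha>2 \<beta>1 \<beta>2 \<longrightarrow>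
            in_GL2_3 A \<longrightarrow> mat_cong3 (A ** B_mat \<alpha>1 \<alpha>2 \<beta>1 \<beta>2) (mat 1) \<longrightarrow>
            (attains_orthogonal_expos (\<mu>_MD M \<alpha>1 \<alpha>2 \<beta>1 \<beta>2) 9 \<longleftrightarrow>
             (\<exists>T\<in>frakM2. mat_cong3 (A ** M ** B_mat \<alpha>1 \<alpha>2 \<beta>1 \<beta>2) T)))"
proof (intro conjI allI impI)
  fix M \<alpha>1 \<alpha>2 \<beta>1 \<beta>2
  assume "admissible M \<alpha>1 \<alpha>2 \<beta>1 \<beta>2"
  then show "at_most_orthogonal_expos (\<mu>_MD M \<alpha>1 \<alpha>2 \<beta>1 \<beta>2) 9"
    by (intro three_digit_ifs.at_most_9 three_digit_ifs.intro)
next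
  show "\<not> (\<exists>n<9. \<forall>M \<alpha>1 \<alpha>2 \<beta>1 \<beta>2. admissible M \<alpha>1 \<alpha>2 \<beta>1 \<beta>2 \<longrightarrow>
      at_most_orthogonal_expos (\<mu>_MD M \<alpha>1 \<alpha>2 \<beta>1 \<beta>2) n)"
  proof
    assume "\<exists>n<9. \<forall>M \<alpha>1 \<alpha>2 \<beta>1 \<beta>2. admissible M \<alpha>1 \<alpha>2 \<beta>1 \<beta>2 \<longrightarrow>
      at_most_orthogonal_expos (\<mu>_MD M \<alpha>1 \<alpha>2 \<beta>1 \<beta>2) n"
    then obtain n where "n < 9" "at_most_orthogonal_expos (\<mu>_MD (mat2 0 1 4 1) 1 0 0 1) n"
      using admissible_example by blast
    moreover have "attains_orthogonal_expos (\<mu>_MD (mat2 0 1 4 1) 1 0 0 1) 9"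
      using admissible_example
      by (intro three_digit_ifs.attains_9 three_digit_ifs.intro) (simp_all add: trace_2 det_2)
    ultimately show False
      by (auto simp: at_most_orthogonal_expos_def attains_orthogonal_expos_def)
  qed
next
  fix M \<alpha>1 \<alpha>2 \<beta>1 \<beta>2 A
  assume adm: "admissible M \<alpha>1 \<alpha>2 \<beta>1 \<beta>2" and A: "in_GL2_3 A"
    and AB: "mat_cong3 (A ** B_mat \<alpha>1 \<alpha>2 \<beta>1 \<beta>2) (mat 1)"
  let ?X = "A ** M ** B_mat \<alpha>1 \<alpha>2 \<beta>1 \<beta>2"
  have "attains_orthogonal_expos (\<mu>_MD M \<alpha>1 \<alpha>2 \<beta>1 \<beta>2) 9 \<longleftrightarrow> \<not> 3 dvd trace M \<and> 3 dvd det M + 1"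
    using adm by (intro three_digit_ifs.attains_9_iff three_digit_ifs.intro)
  also have "\<dots> \<longleftrightarrow> \<not> 3 dvd trace ?X \<and> 3 dvd det ?X + 1"
  proof -
    have "3 dvd trace ?X \<longleftrightarrow> 3 dvd trace M"
      by (rule cong_dvd_iff[OF conjugate_trace_det(1)[OF A AB]])
    moreover have "3 dvd det ?X + 1 \<longleftrightarrow> 3 dvd det M + 1"
      by (rule cong_dvd_iff[OF cong_add[OF conjugate_trace_det(2)[OF A AB] cong_refl]])
    ultimately show ?thesis by blast
  qed
  also have "\<dots> \<longleftrightarrow> (\<exists>T\<in>frakM2. mat_cong3 ?X T)" by (rule frakM2_iff_trace_det[symmetric])
  finally show "attains_orthogonal_expos (\<mu>_MD M \<alpha>1 \<alpha>2 \<beta>1 \<beta>2) 9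
      \<longleftrightarrow> (\<exists>T\<in>frakM2. mat_cong3 ?X T)" .
qed

end
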